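(* Fix an integer $k\ge1$. Let $\ell>2$ be prime, let $N\in\mathbb F_\ell^*$, and let $a_1,\ldots,a_k\in\mathbb F_\ell^*$ be distinct. Then $$\left|\,\Bigl|\bigcup_{j=1}^kH_{a_j}(N;\ell)\Bigr|-\ell\bigl(1-2^{-k}\bigr)\right|\le(k-1+2^{-k})\sqrt\ell+k.$$
   Context: For $a,N\in\mathbb F_\ell^*$, $H_a(N;\ell)=\{ax+Nx^{-1}:x\in\mathbb F_\ell^*\}\subseteq\mathbb F_\ell$. *)

theory Defs
  imports "HOL-Analysis.Analysis" "Berlekamp_Zassenhaus.Finite_Field"
begin

text \<open>
  The prime field with \<open>l\<close> elements is the type \<^typ>\<open>'p mod_ring\<close>, where the index
  type \<open>'p\<close> of class \<^class>\<open>prime_card\<close> has the prime cardinality \<open>l\<close>.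
\<close>

definition H :: "'p::prime_card mod_ring \<Rightarrow> 'p mod_ring \<Rightarrow> 'p mod_ring set" where
  "H a N = {a * x + N * inverse x | x. x \<noteq> 0}"

end

theory Submission
  imports Defs
begin

hide_const (open) up_ring.coeff up_ring.monom module.smult Coset.order

text \<open>
  Write \<open>p\<close> for the size of the field and \<open>r\<close> for its square root. The equation
  \<open>y = a x + N / x\<close> is the quadratic \<open>a x\<^sup>2 - y x + N = 0\<close>, so \<open>y\<close> lies in \<open>H a N\<close> exactly when
  \<open>y\<^sup>2 - 4 a N\<close> is a square (\<open>mem_H_iff\<close>). The complement of the union is therefore the set of those \<open>y\<close>
  for which \<open>y\<^sup>2 - c\<close> is a nonresidue for each of the \<open>k\<close> distinct nonzero values \<open>c = 4 a\<^sub>j N\<close>.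
  Expanding \<open>\<Prod>c. 1 - \<chi> (y\<^sup>2 - c)\<close> over subsets \<open>S\<close>, where \<open>\<chi>\<close> is the quadratic character, counts this set up to the
  contribution of the zeros of the factors, which costs at most \<open>k\<close>. After division by \<open>2 ^ k\<close> the empty subset gives the main term \<open>p / 2 ^ k\<close>. A
  subset with \<open>s\<close> elements contributes a character sum of a polynomial of degree \<open>2 s\<close>. If these sums are at
  most \<open>(2 s - 1) r\<close>, which is the bound of Weil, then summing over \<open>S\<close> gives precisely the claim.

  Substituting \<open>u = y\<^sup>2\<close> turns such a sum into two sums \<open>\<Sum>u. \<chi> (\<Prod>z\<in>Z. u - z)\<close>, with \<open>s\<close> and \<open>s + 1\<close> elements in \<open>Z\<close>
  (\<open>square_char_sum_eq\<close>). A fractional linear substitution reduces even \<open>card Z\<close> to odd \<open>card Z\<close>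
  (\<open>char_sum_even_reduction\<close>), so that everything rests on the case \<open>card Z = 2 g + 1\<close>, in which the sum counts the points of the
  hyperelliptic curve \<open>y\<^sup>2 = f x\<close> of genus \<open>g\<close> with \<open>f = \<Prod>z. x - z\<close>.

  The points are counted by the method of Stepanov, in the following shape. On the square of the curve, with
  coordinates \<open>(x, y)\<close> and \<open>(z, w)\<close>, consider functions \<open>G = \<Sum> v x^i z^b (y w)^\<sigma>\<close> whose pole orders at infinity are at most \<open>A\<close>
  in the first and \<open>B\<close> in the second factor. If \<open>G\<close> vanishes to order \<open>m\<close> along the diagonal, then its restriction to the graph
  of Frobenius, which is a polynomial \<open>\<Phi>\<close> in \<open>x\<close>, vanishes to order \<open>m\<close> at all rational points of the curve. Since
  \<open>A < p\<close>, the terms of \<open>\<Phi>\<close> have distinct degrees, so \<open>\<Phi>\<close> is not zero and \<open>m\<close> times the number of points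
  is at most \<open>A + p B\<close>. Such a \<open>G\<close> exists as soon as there are more coefficients \<open>v\<close> than linear conditions.
  The point that makes the resulting constant sharp is \<open>support_shrinks\<close>: when \<open>j\<close> derivatives of \<open>G\<close> vanish on the diagonal, then,
  by a Vandermonde argument, the \<open>j\<close> highest total pole orders do not occur in \<open>G\<close>. Hence the derivative of
  order \<open>j\<close> imposes only as many conditions as a function of pole order \<open>A + B + j (2 g - 2)\<close> has coefficients,
  where the naive count has \<open>2 g - 1\<close> for \<open>2 g - 2\<close>. The outcome is \<open>char_sum_odd_bound\<close>: the sum is at most
  \<open>(2 g p - 1) / m\<close> for every positive \<open>m\<close> with \<open>m\<^sup>2 + m < p\<close>. So \<open>m\<close> can be taken close to \<open>r\<close>, and the bound is close to \<open>2 g r\<close>.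

  Replacing \<open>r\<close> by an integer costs a little, and this makes the bound weaker than \<open>2 g r\<close>. Two remarks absorb the
  loss. Exactly one of the two sums above has even \<open>card Z\<close>, and it has a smaller genus
  than its degree suggests, which leaves a spare \<open>r\<close> for each \<open>S\<close>. And only \<open>r > 2 ^ k\<close> has to be considered
  when \<open>k > 1\<close>: for smaller \<open>r\<close> the lower bound for the number of joint nonresidues is trivial, and the upper bound for \<open>k\<close> values \<open>c\<close>
  follows from the one for \<open>k - 1\<close> of them.
\<close>

section \<open>The quadratic character of a prime field\<close>

lemma mod_ring_fermat:
  fixes x :: "'p::prime_card mod_ring"
  shows "x ^ CARD('p) = x"
  using finite_field_power_card_eq_same[of x] by simp

lemma mod_ring_of_nat_eq_0_iff:
  "(of_nat n :: 'p::prime_card mod_ring) = 0 \<longleftrightarrow> CARD('p) dvd n"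
  using of_nat_eq_0_iff_char_dvd[where 'a="'p mod_ring"] by simp

lemma odd_prime_card:
  assumes "2 < CARD('p::prime_card)"
  shows "odd CARD('p)"
  using prime_odd_nat[OF prime_card[where 'a='p]] assms by auto

lemma mod_ring_two_neq_0:
  assumes "2 < CARD('p::prime_card)"
  shows "(2 :: 'p mod_ring) \<noteq> 0"
  using mod_ring_of_nat_eq_0_iff[where 'p='p, of 2] assms by (auto dest: dvd_imp_le)

text \<open>
  The quadratic character in the form of the criterion of Euler: for odd \<open>p\<close> the power with exponent
  \<open>(p - 1) / 2 = p div 2\<close> takes only the values \<open>0\<close>, \<open>1\<close> and \<open>-1\<close>. This makes
  multiplicativity immediate and is the form in which the character meets the Frobenius map below.
\<close>

definition qchar :: "'p::prime_card mod_ring \<Rightarrow> int" where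
  "qchar x = (if x = 0 then 0 else if x ^ (CARD('p) div 2) = 1 then 1 else -1)"

lemma half_power_cases:
  fixes x :: "'p::prime_card mod_ring"
  assumes "2 < CARD('p)" and "x \<noteq> 0"
  shows "x ^ (CARD('p) div 2) = 1 \<or> x ^ (CARD('p) div 2) = -1"
proof -
  let ?h = "CARD('p) div 2"
  have "CARD('p) = Suc (2 * ?h)" using odd_prime_card[OF assms(1)] by presburger
  then have "x * (x ^ ?h)\<^sup>2 = x"
    using mod_ring_fermat[of x] by (metis power_Suc power_mult mult.commute)
  then have "(x ^ ?h)\<^sup>2 = 1" using assms(2) by simp
  then show ?thesis by (simp add: power2_eq_1_iff)
qed

lemma minus_one_neq_one:
  assumes "2 < CARD('p::prime_card)"
  shows "(-1 :: 'p mod_ring) \<noteq> 1"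
proof
  assume "(-1 :: 'p mod_ring) = 1"
  then have "(1 + 1 :: 'p mod_ring) = 0" by (metis add.right_inverse)
  then show False using mod_ring_two_neq_0[OF assms] by simp
qed

lemma qchar_0 [simp]: "qchar 0 = 0" by (simp add: qchar_def)

lemma qchar_1 [simp]: "qchar 1 = 1" by (simp add: qchar_def)

lemma qchar_eq_0_iff [simp]: "qchar x = 0 \<longleftrightarrow> x = 0" by (simp add: qchar_def)

lemma qchar_cases: "x = 0 \<and> qchar x = 0 \<or> qchar x = 1 \<or> qchar x = -1"
  by (simp add: qchar_def)

lemma of_int_qchar:
  fixes x :: "'p::prime_card mod_ring"
  assumes "2 < CARD('p)"
  shows "of_int (qchar x) = x ^ (CARD('p) div 2)"
proof (cases "x = 0")
  case True
  moreover have "0 < CARD('p) div 2" using assms by simp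
  ultimately show ?thesis by (simp add: qchar_def power_0_left)
next
  case False
  then show ?thesis using half_power_cases[OF assms False] by (auto simp: qchar_def)
qed

lemma qchar_mult:
  fixes x y :: "'p::prime_card mod_ring"
  assumes "2 < CARD('p)"
  shows "qchar (x * y) = qchar x * qchar y"
proof (cases "x = 0 \<or> y = 0")
  case False
  then show ?thesis
    using half_power_cases[OF assms, of x] half_power_cases[OF assms, of y] minus_one_neq_one[OF assms]
    by (auto simp: qchar_def power_mult_distrib)
qed auto

lemma qchar_prod:
  fixes f :: "'b \<Rightarrow> 'p::prime_card mod_ring"
  assumes "2 < CARD('p)"
  shows "qchar (\<Prod>i\<in>A. f i) = (\<Prod>i\<in>A. qchar (f i))"
  by (induction A rule: infinite_finite_induct) (simp_all add: qchar_mult[OF assms])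

lemma qchar_square:
  fixes x :: "'p::prime_card mod_ring"
  assumes "2 < CARD('p)" and "x \<noteq> 0"
  shows "qchar (x\<^sup>2) = 1"
  using qchar_cases[of x] assms by (auto simp: power2_eq_square qchar_mult)

lemma card_square_roots_le:
  fixes u :: "'p::prime_card mod_ring"
  shows "card {y. y\<^sup>2 = u} \<le> 2"
proof (cases "\<exists>y. y\<^sup>2 = u")
  case True
  then obtain y where "y\<^sup>2 = u" by blast
  then have "{y. y\<^sup>2 = u} \<subseteq> {y, -y}" by (auto simp: power2_eq_iff)
  then have "card {y. y\<^sup>2 = u} \<le> card {y, -y}" by (rule card_mono[rotated]) simp
  also have "\<dots> \<le> 2" by (simp add: card_insert_if)
  finally show ?thesis .
qed simp

text \<open>
  Squaring is at most two-to-one on the \<open>p - 1\<close> nonzero elements, so there are at least \<open>(p - 1) / 2\<close> nonzero squares. All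
  of them are roots of \<open>X ^ ((p - 1) / 2) - 1\<close>, which has no room for further roots.
\<close>

lemma qchar_eq_1_imp_square:
  fixes u :: "'p::prime_card mod_ring"
  assumes p: "2 < CARD('p)" and "qchar u = 1"
  shows "\<exists>y. y\<^sup>2 = u"
proof -
  let ?h = "CARD('p) div 2"
  define Sq where "Sq = (\<lambda>y::'p mod_ring. y\<^sup>2) ` (UNIV - {0})"
  define T where "T = {u :: 'p mod_ring. u ^ ?h = 1}"
  have ph: "CARD('p) = Suc (2 * ?h)" using odd_prime_card[OF p] by presburger
  have h0: "0 < ?h" using p by simp
  have "Sq \<subseteq> T"
  proof
    fix u assume "u \<in> Sq"
    then obtain y :: "'p mod_ring" where y: "y \<noteq> 0" "u = y\<^sup>2" by (auto simp: Sq_def)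
    then have "qchar u = 1" using qchar_square[OF p] by simp
    then have "u ^ ?h = 1" using of_int_qchar[OF p, of u] by simp
    then show "u \<in> T" by (simp add: T_def)
  qed
  moreover have "card T \<le> ?h"
  proof -
    let ?P = "monom 1 ?h - 1 :: 'p mod_ring poly"
    have c: "coeff ?P ?h = 1" using h0 by simp
    then have "?P \<noteq> 0" by (metis coeff_0 zero_neq_one)
    then have "card {x. poly ?P x = 0} \<le> degree ?P" by (rule card_poly_roots_bound)
    also have "\<dots> \<le> ?h" by (rule degree_diff_le) (simp_all add: degree_monom_le)
    also have "{x. poly ?P x = 0} = T" by (auto simp: T_def poly_monom)
    finally show ?thesis .
  qed
  moreover have "2 * ?h \<le> 2 * card Sq"
  proof -
    have "2 * ?h = card (UNIV - {0 :: 'p mod_ring})" using ph by (simp add: card_Diff_subset)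
    also have "\<dots> \<le> card (\<Union>u\<in>Sq. {y. y\<^sup>2 = u})"
      by (rule card_mono) (auto simp: Sq_def)
    also have "\<dots> \<le> (\<Sum>u\<in>Sq. card {y. y\<^sup>2 = u})" by (rule card_UN_le) simp
    also have "\<dots> \<le> (\<Sum>u\<in>Sq. 2)" by (rule sum_mono) (rule card_square_roots_le)
    finally show ?thesis by simp
  qed
  ultimately have "Sq = T" by (intro card_seteq) auto
  moreover have "u \<in> T" using of_int_qchar[OF p, of u] assms(2) by (simp add: T_def)
  ultimately show ?thesis by (auto simp: Sq_def)
qed

lemma card_square_roots:
  fixes u :: "'p::prime_card mod_ring"
  assumes p: "2 < CARD('p)"
  shows "int (card {y. y\<^sup>2 = u}) = 1 + qchar u"
proof (cases "u = 0")
  case False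
  show ?thesis
  proof (cases "\<exists>y. y\<^sup>2 = u")
    case True
    then obtain y where y: "y\<^sup>2 = u" by blast
    with False have y0: "y \<noteq> 0" by auto
    have "y \<noteq> -y"
    proof
      assume "y = -y"
      then have "2 * y = 0" by (metis add.right_inverse mult_2)
      then show False using y0 mod_ring_two_neq_0[OF p] by simp
    qed
    moreover have "{y. y\<^sup>2 = u} = {y, -y}" using y by (auto simp: power2_eq_iff)
    moreover have "qchar u = 1" using qchar_square[OF p y0] y by simp
    ultimately show ?thesis by simp
  next
    case nosq: False
    then have "qchar u = -1" using qchar_eq_1_imp_square[OF p, of u] qchar_cases[of u] False by auto
    then show ?thesis using nosq by simp
  qed
qed simp

lemma sum_over_squares:
  fixes g :: "'p::prime_card mod_ring \<Rightarrow> int"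
  assumes p: "2 < CARD('p)"
  shows "(\<Sum>y\<in>UNIV. g (y\<^sup>2)) = (\<Sum>u\<in>UNIV. (1 + qchar u) * g u)"
proof -
  have "(\<Sum>y\<in>UNIV. g (y\<^sup>2)) = (\<Sum>u\<in>UNIV. \<Sum>y | y \<in> UNIV \<and> y\<^sup>2 = u. g (y\<^sup>2))"
    by (rule sum.group[symmetric]) auto
  also have "\<dots> = (\<Sum>u\<in>UNIV. (1 + qchar u) * g u)"
    by (rule sum.cong) (simp_all add: card_square_roots[OF p, symmetric])
  finally show ?thesis .
qed

lemma sum_qchar_eq_0:
  assumes p: "2 < CARD('p::prime_card)"
  shows "(\<Sum>u\<in>(UNIV :: 'p mod_ring set). qchar u) = 0"
  using sum_over_squares[OF p, of "\<lambda>_. 1"] by (simp add: sum.distrib)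

section \<open>Solving an underdetermined linear system\<close>

text \<open>
  Over a finite field a pigeonhole argument suffices: two distinct coefficient vectors have the same values, and
  their difference is a solution.
\<close>

lemma homogeneous_system_nontrivial:
  fixes L :: "('i \<Rightarrow> 'a::{finite,field}) \<Rightarrow> 'k \<Rightarrow> 'a"
  assumes "finite I" and "finite K" and "card K < card I"
    and linear: "\<And>v w k. L (\<lambda>i. v i - w i) k = L v k - L w k"
  obtains v where "\<exists>i\<in>I. v i \<noteq> 0" and "\<And>i. i \<notin> I \<Longrightarrow> v i = 0" and "\<And>k. k \<in> K \<Longrightarrow> L v k = 0"
proof -
  define ext where "ext v = (\<lambda>i. if i \<in> I then v i else 0)" for v :: "'i \<Rightarrow> 'a"
  let ?A = "I \<rightarrow>\<^sub>E (UNIV :: 'a set)" and ?B = "K \<rightarrow>\<^sub>E (UNIV :: 'a set)"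
  define G where "G v = restrict (L (ext v)) K" for v
  have "1 < CARD('a)"
    using card_mono[of "UNIV :: 'a set" "{0,1}"] by simp
  then have "card ?B < card ?A"
    using assms by (simp add: card_PiE)
  moreover have "card (G ` ?A) \<le> card ?B"
    using assms(2) by (intro card_mono finite_PiE) (auto simp: G_def)
  ultimately have "\<not> inj_on G ?A"
    by (intro pigeonhole) simp
  then obtain v w where vw: "v \<in> ?A" "w \<in> ?A" "v \<noteq> w" "G v = G w"
    by (auto simp: inj_on_def)
  show thesis
  proof (rule that[of "\<lambda>i. ext v i - ext w i"])
    show "\<exists>i\<in>I. ext v i - ext w i \<noteq> 0"
      using vw PiE_ext[OF vw(1,2)] by (auto simp: ext_def)
    show "L (\<lambda>i. ext v i - ext w i) k = 0" if "k \<in> K" for k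
      using that fun_cong[OF vw(4), of k] by (simp add: linear G_def)
  qed (simp add: ext_def)
qed

section \<open>A derivation on the curve and leading terms at infinity\<close>

text \<open>
  On the curve \<open>y\<^sup>2 = f x\<close>, with \<open>f\<close> squarefree, the derivation \<open>D = y d/dx\<close> has neither zeros nor poles at finite points,
  including the branch points. It interchanges functions \<open>r x\<close> (type \<open>False\<close>) and functions \<open>r x * y\<close> (type \<open>True\<close>):
  \<open>D r = r' y\<close> and \<open>D (r y) = f r' + f' r / 2\<close>. So \<open>curve_deriv f \<sigma> r\<close> is the polynomial part of \<open>D (r y^\<sigma>)\<close>, and the
  type of the result is \<open>\<not> \<sigma>\<close>.
\<close>

definition curve_deriv :: "'a::field poly \<Rightarrow> bool \<Rightarrow> 'a poly \<Rightarrow> 'a poly" where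
  "curve_deriv f \<sigma> r = (if \<sigma> then f * pderiv r + smult (1 / 2) (pderiv f * r) else pderiv r)"

primrec curve_deriv_iter :: "'a::field poly \<Rightarrow> bool \<Rightarrow> nat \<Rightarrow> 'a poly \<Rightarrow> 'a poly" where
  "curve_deriv_iter f \<sigma> 0 r = r"
| "curve_deriv_iter f \<sigma> (Suc j) r = curve_deriv f (\<sigma> \<noteq> odd j) (curve_deriv_iter f \<sigma> j r)"

lemma curve_deriv_add: "curve_deriv f \<sigma> (r + s) = curve_deriv f \<sigma> r + curve_deriv f \<sigma> s"
  by (simp add: curve_deriv_def pderiv_add algebra_simps smult_add_right)

lemma curve_deriv_smult: "curve_deriv f \<sigma> (smult c r) = smult c (curve_deriv f \<sigma> r)"
  by (simp add: curve_deriv_def pderiv_smult smult_add_right mult.commute)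

lemma curve_deriv_iter_0 [simp]: "curve_deriv_iter f \<sigma> j 0 = 0"
  by (induction j) (simp_all add: curve_deriv_def)

lemma curve_deriv_iter_add:
  "curve_deriv_iter f \<sigma> j (r + s) = curve_deriv_iter f \<sigma> j r + curve_deriv_iter f \<sigma> j s"
  by (induction j) (simp_all add: curve_deriv_add)

lemma curve_deriv_iter_smult:
  "curve_deriv_iter f \<sigma> j (smult c r) = smult c (curve_deriv_iter f \<sigma> j r)"
  by (induction j) (simp_all add: curve_deriv_smult)

lemma curve_deriv_iter_sum:
  "curve_deriv_iter f \<sigma> j (\<Sum>k\<in>I. r k) = (\<Sum>k\<in>I. curve_deriv_iter f \<sigma> j (r k))"
  by (induction I rule: infinite_finite_induct) (simp_all add: curve_deriv_iter_add)

lemma curve_deriv_iter_mult_const: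
  assumes "pderiv c = 0"
  shows "curve_deriv_iter f \<sigma> j (r * c) = curve_deriv_iter f \<sigma> j r * c"
  by (induction j) (simp_all add: curve_deriv_def pderiv_mult assms algebra_simps)

text \<open>
  In characteristic \<open>p\<close> the exponent \<open>h + 1 = (p + 1) / 2\<close> equals \<open>1 / 2\<close>, so \<open>f ^ (h + 1)\<close> is differentiated as if it
  were \<open>y\<close> times a constant. That constant is \<open>y ^ p\<close>, the \<open>y\<close>-coordinate of the image under Frobenius.
\<close>

lemma curve_deriv_iter_mult_half_power:
  fixes f :: "'a::field poly"
  assumes half: "2 * of_nat (Suc h) = (1 :: 'a)" and two: "(2 :: 'a) \<noteq> 0"
  shows "curve_deriv_iter f False j (r * f ^ Suc h)
    = curve_deriv_iter f True j r * f ^ (if odd j then h else Suc h)"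
proof (induction j)
  case (Suc j)
  let ?P = "curve_deriv_iter f True j r"
  have h1: "of_nat (Suc h) = (1 / 2 :: 'a)" using half two by (simp add: field_simps)
  have h2: "of_nat h = (- 1 / 2 :: 'a)"
    using h1 two by (simp add: field_simps) (metis add.commute add_diff_cancel_left' diff_add_eq_diff_diff_swap diff_self minus_diff_eq one_add_one uminus_add_conv_diff)
  show ?case
  proof (cases "odd j")
    case False
    have "pderiv (?P * f ^ Suc h) = f ^ h * (f * pderiv ?P + smult (1 / 2) (pderiv f * ?P))"
      unfolding pderiv_mult pderiv_power_Suc h1 by (simp add: algebra_simps smult_add_right)
    then show ?thesis using False Suc.IH by (simp add: curve_deriv_def mult.commute)
  next
    case True
    have "f * pderiv (f ^ h) = smult (- 1 / 2) (f ^ h * pderiv f)"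
    proof (cases h)
      case 0
      then have "(2 :: 'a) = 1" using half by simp
      then show ?thesis by (metis add_cancel_right_right one_add_one zero_neq_one)
    next
      case (Suc n)
      have "pderiv (f ^ h) = smult (- 1 / 2) (f ^ n * pderiv f)"
        unfolding Suc pderiv_power_Suc using h2 Suc by simp
      then show ?thesis using Suc by (simp add: algebra_simps)
    qed
    moreover have "f * pderiv (?P * f ^ h) = pderiv ?P * f ^ Suc h + ?P * (f * pderiv (f ^ h))"
      by (simp add: pderiv_mult algebra_simps)
    ultimately have "f * pderiv (?P * f ^ h) + smult (1 / 2) (pderiv f * (?P * f ^ h))
      = pderiv ?P * f ^ Suc h + (?P * smult (- 1 / 2) (f ^ h * pderiv f) + smult (1 / 2) (pderiv f * (?P * f ^ h)))"
      by simp
    also have "\<dots> = pderiv ?P * f ^ Suc h" by (simp add: mult_ac)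
    finally show ?thesis using True Suc.IH by (simp add: curve_deriv_def)
  qed
qed simp

text \<open>
  At infinity \<open>x\<close> has pole order \<open>2\<close> and \<open>y\<close> has pole order \<open>d = degree f\<close>. The function \<open>r y^\<sigma>\<close> has pole order at most \<open>W\<close>,
  with coefficient \<open>\<kappa>\<close> in front of the term of pole order exactly \<open>W\<close>. The existence clause forces
  \<open>\<kappa> = 0\<close> if no monomial of type \<open>\<sigma>\<close> has pole order \<open>W\<close>; without it \<open>\<kappa>\<close> would be arbitrary in that case.
\<close>

definition leading :: "nat \<Rightarrow> bool \<Rightarrow> 'a::field poly \<Rightarrow> nat \<Rightarrow> 'a \<Rightarrow> bool" where
  "leading d \<sigma> r W \<kappa> \<longleftrightarrow>
     (\<kappa> \<noteq> 0 \<longrightarrow> (\<exists>c. 2 * c + of_bool \<sigma> * d = W)) \<and>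
     (\<forall>c. W \<le> 2 * c + of_bool \<sigma> * d \<longrightarrow> coeff r c = (if 2 * c + of_bool \<sigma> * d = W then \<kappa> else 0))"

lemma leading_monom: "leading d \<sigma> (monom 1 i) (2 * i + of_bool \<sigma> * d) 1"
  by (auto simp: leading_def)

lemma leading_0: "leading d \<sigma> 0 W 0"
  by (auto simp: leading_def)

lemma leading_add:
  "leading d \<sigma> r W \<kappa> \<Longrightarrow> leading d \<sigma> s W \<mu> \<Longrightarrow> leading d \<sigma> (r + s) W (\<kappa> + \<mu>)"
  unfolding leading_def by (metis add.right_neutral add_0 coeff_add)

lemma leading_smult: "leading d \<sigma> r W \<kappa> \<Longrightarrow> leading d \<sigma> (smult c r) W (c * \<kappa>)"
  unfolding leading_def by auto

lemma leading_sum: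
  "(\<And>k. k \<in> I \<Longrightarrow> leading d \<sigma> (r k) W (\<kappa> k)) \<Longrightarrow> leading d \<sigma> (\<Sum>k\<in>I. r k) W (\<Sum>k\<in>I. \<kappa> k)"
  by (induction I rule: infinite_finite_induct) (simp_all add: leading_0 leading_add)

lemma leading_less: "leading d \<sigma> r W \<kappa> \<Longrightarrow> W < W' \<Longrightarrow> leading d \<sigma> r W' 0"
  unfolding leading_def by auto

lemma leading_of_0: "leading d \<sigma> 0 W \<kappa> \<Longrightarrow> \<kappa> = 0"
  unfolding leading_def by (metis coeff_0 order_refl)

lemma leading_coeff_above_eq_0: "leading d \<sigma> r W \<kappa> \<Longrightarrow> W < 2 * c + of_bool \<sigma> * d \<Longrightarrow> coeff r c = 0"
  unfolding leading_def by auto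

lemma leading_mult_monom:
  assumes "leading d \<sigma> r W \<kappa>"
  shows "leading d \<sigma> (r * monom 1 b) (W + 2 * b) \<kappa>"
  unfolding leading_def
proof (intro conjI allI impI)
  assume "\<kappa> \<noteq> 0"
  then obtain c where "2 * c + of_bool \<sigma> * d = W" using assms by (auto simp: leading_def)
  then have "2 * (c + b) + of_bool \<sigma> * d = W + 2 * b" by simp
  then show "\<exists>c. 2 * c + of_bool \<sigma> * d = W + 2 * b" by blast
next
  fix c assume c: "W + 2 * b \<le> 2 * c + of_bool \<sigma> * d"
  have co: "coeff (r * monom 1 b) c = (if b \<le> c then coeff r (c - b) else 0)"
    by (simp add: mult.commute[of r] coeff_monom_mult)
  show "coeff (r * monom 1 b) c = (if 2 * c + of_bool \<sigma> * d = W + 2 * b then \<kappa> else 0)"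
  proof (cases "b \<le> c")
    case True
    then have "W \<le> 2 * (c - b) + of_bool \<sigma> * d"
      "2 * (c - b) + of_bool \<sigma> * d = W \<longleftrightarrow> 2 * c + of_bool \<sigma> * d = W + 2 * b"
      using c by auto
    then show ?thesis using assms co True by (simp add: leading_def)
  next
    case False
    have "\<kappa> = 0" if "2 * c + of_bool \<sigma> * d = W + 2 * b"
    proof (rule ccontr)
      assume "\<kappa> \<noteq> 0"
      then obtain c' where "2 * c' + of_bool \<sigma> * d = W" using assms by (auto simp: leading_def)
      then show False using that False by linarith
    qed
    then show ?thesis using co False by simp
  qed
qed

text \<open>
  Multiplication by \<open>y\<close> leaves the polynomial unchanged and only turns it from a function in its own right into
  the coefficient of \<open>y\<close>.
\<close>

lemma leading_retype: "leading d False r W \<kappa> \<Longrightarrow> leading d True r (W + d) \<kappa>"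
  unfolding leading_def by auto

lemma coeff_mult_single_term:
  assumes "\<And>u. u \<le> c \<Longrightarrow> u \<noteq> d \<Longrightarrow> coeff f u * coeff r (c - u) = 0"
  shows "coeff (f * r) c = (if d \<le> c then coeff f d * coeff r (c - d) else 0)"
proof -
  have "coeff (f * r) c = (\<Sum>u\<le>c. if u = d then coeff f d * coeff r (c - d) else 0)"
    unfolding coeff_mult by (rule sum.cong) (use assms in auto)
  then show ?thesis by simp
qed

text \<open>
  The relation \<open>y * y = f x\<close> turns a product of two functions of type \<open>True\<close> into one of type \<open>False\<close>.
\<close>

lemma leading_mult_curve:
  assumes f: "degree f = d" "coeff f d = 1" and r: "leading d True r W \<kappa>"
  shows "leading d False (f * r) (W + d) \<kappa>"
  unfolding leading_def
proof (intro conjI allI impI)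
  assume "\<kappa> \<noteq> 0"
  then obtain c where "2 * c + d = W" using r by (auto simp: leading_def)
  then have "2 * (c + d) = W + d" by simp
  then show "\<exists>c. 2 * c + of_bool False * d = W + d" by (intro exI[of _ "c + d"]) simp
next
  fix c assume "W + d \<le> 2 * c + of_bool False * d"
  then have c: "W + d \<le> 2 * c" by simp
  have "coeff (f * r) c = (if d \<le> c then coeff f d * coeff r (c - d) else 0)"
  proof (rule coeff_mult_single_term)
    fix u assume u: "u \<le> c" "u \<noteq> d"
    show "coeff f u * coeff r (c - u) = 0"
    proof (cases "u < d")
      case True
      then have "W < 2 * (c - u) + of_bool True * d" using u c by simp
      then show ?thesis using leading_coeff_above_eq_0[OF r] by simp
    next
      case False
      then show ?thesis using u f by (simp add: coeff_eq_0)
    qed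
  qed
  also have "\<dots> = (if 2 * c = W + d then \<kappa> else 0)"
  proof (cases "d \<le> c")
    case True
    then have "W \<le> 2 * (c - d) + d" "2 * (c - d) + d = W \<longleftrightarrow> 2 * c = W + d" using c by auto
    then show ?thesis using r f True by (simp add: leading_def)
  next
    case False
    have "\<kappa> = 0" if "2 * c = W + d"
    proof (rule ccontr)
      assume "\<kappa> \<noteq> 0"
      then obtain c' where "2 * c' + d = W" using r by (auto simp: leading_def)
      then show False using that False by linarith
    qed
    then show ?thesis using False by simp
  qed
  finally show "coeff (f * r) c = (if 2 * c + of_bool False * d = W + d then \<kappa> else 0)" by simp
qed

text \<open>
  The products \<open>f r'\<close> and \<open>f' r / 2\<close> pair the same coefficients of \<open>f\<close> and \<open>r\<close>, so they combine into one convolution in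
  which the leading term can be read off.
\<close>

lemma coeff_curve_deriv_True:
  "coeff (curve_deriv f True r) c
    = (\<Sum>u\<le>Suc c. (of_nat (Suc c - u) + of_nat u / 2) * (coeff f u * coeff r (Suc c - u)))"
proof -
  have "coeff (f * pderiv r) c = (\<Sum>u\<le>c. of_nat (Suc c - u) * (coeff f u * coeff r (Suc c - u)))"
    unfolding coeff_mult coeff_pderiv by (rule sum.cong) (auto simp: Suc_diff_le)
  also have "\<dots> = (\<Sum>u\<le>Suc c. of_nat (Suc c - u) * (coeff f u * coeff r (Suc c - u)))" by simp
  finally have 1: "coeff (f * pderiv r) c = \<dots>" .
  have "coeff (pderiv f * r) c = (\<Sum>u\<le>c. of_nat (Suc u) * (coeff f (Suc u) * coeff r (c - u)))"
    unfolding coeff_mult coeff_pderiv by (rule sum.cong) auto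
  also have "\<dots> = (\<Sum>u\<le>Suc c. of_nat u * (coeff f u * coeff r (Suc c - u)))"
    by (subst sum.atMost_Suc_shift) simp
  finally have 2: "coeff (pderiv f * r) c = \<dots>" .
  show ?thesis
    unfolding curve_deriv_def using 1 2
    by (simp add: sum_divide_distrib sum.distrib[symmetric] distrib_right del: sum.atMost_Suc)
qed

text \<open>
  With \<open>d = e + 2\<close>, the derivation raises pole orders by \<open>e\<close> and multiplies the leading coefficient by half the
  pole order, whatever the type: for \<open>x^c\<close> the factor is \<open>c\<close>, for \<open>x^c y\<close> it is \<open>c + d / 2\<close>.
\<close>

lemma leading_curve_deriv:
  fixes f :: "'a::field poly"
  assumes f: "degree f = e + 2" "coeff f (e + 2) = 1" and two: "(2 :: 'a) \<noteq> 0"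
    and r: "leading (e + 2) \<sigma> r W \<kappa>"
  shows "leading (e + 2) (\<not> \<sigma>) (curve_deriv f \<sigma> r) (W + e) (of_nat W / 2 * \<kappa>)"
  unfolding leading_def
proof (intro conjI allI impI)
  assume "of_nat W / 2 * \<kappa> \<noteq> 0"
  then have W: "W \<noteq> 0" and "\<kappa> \<noteq> 0" by (cases W; simp)+
  then obtain c where c: "2 * c + of_bool \<sigma> * (e + 2) = W" using r by (auto simp: leading_def)
  show "\<exists>c. 2 * c + of_bool (\<not> \<sigma>) * (e + 2) = W + e"
  proof (cases \<sigma>)
    case True
    then show ?thesis using c by (intro exI[of _ "c + e + 1"]) simp
  next
    case False
    then show ?thesis using c W by (intro exI[of _ "c - 1"]) auto
  qed
next
  fix c assume c: "W + e \<le> 2 * c + of_bool (\<not> \<sigma>) * (e + 2)"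
  show "coeff (curve_deriv f \<sigma> r) c
    = (if 2 * c + of_bool (\<not> \<sigma>) * (e + 2) = W + e then of_nat W / 2 * \<kappa> else 0)"
  proof (cases \<sigma>)
    case False
    have "coeff r (Suc c) = (if 2 * Suc c = W then \<kappa> else 0)"
      using r c False by (simp add: leading_def)
    moreover have "of_nat (Suc c) = (of_nat W / 2 :: 'a)" if "2 * Suc c = W"
    proof -
      have "(of_nat W :: 'a) = 2 * of_nat (Suc c)" unfolding that[symmetric] by simp
      then show ?thesis using two by simp
    qed
    ultimately show ?thesis using False by (auto simp: curve_deriv_def coeff_pderiv)
  next
    case True
    let ?d = "e + 2"
    let ?t = "\<lambda>u. (of_nat (Suc c - u) + of_nat u / 2) * (coeff f u * coeff r (Suc c - u))"
    have c': "W + e \<le> 2 * c" using c True by simp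
    have r': "leading ?d True r W \<kappa>" using r True by simp
    have z: "?t u = (if u = ?d then ?t ?d else 0)" if u: "u \<le> Suc c" for u
    proof (cases "u < ?d")
      case lt: True
      then have "W < 2 * (Suc c - u) + of_bool True * ?d" using u c' by simp
      then have "coeff r (Suc c - u) = 0" by (rule leading_coeff_above_eq_0[OF r'])
      then show ?thesis using lt by simp
    next
      case False
      then show ?thesis using u f by (auto simp: coeff_eq_0)
    qed
    have "coeff (curve_deriv f True r) c = (\<Sum>u\<le>Suc c. if u = ?d then ?t ?d else 0)"
      unfolding coeff_curve_deriv_True by (rule sum.cong) (use z in auto)
    also have "\<dots> = (if ?d \<le> Suc c then ?t ?d else 0)" by (simp del: sum.atMost_Suc)
    also have "\<dots> = (if 2 * c = W + e then of_nat W / 2 * \<kappa> else 0)"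
    proof (cases "?d \<le> Suc c")
      case le: True
      then have "W \<le> 2 * (Suc c - ?d) + ?d" "2 * (Suc c - ?d) + ?d = W \<longleftrightarrow> 2 * c = W + e"
        using c' by auto
      then have co: "coeff r (Suc c - ?d) = (if 2 * c = W + e then \<kappa> else 0)"
        using r True by (simp add: leading_def)
      have "of_nat (Suc c - ?d) + of_nat ?d / 2 = (of_nat W / 2 :: 'a)" if "2 * c = W + e"
      proof -
        have "W = 2 * (Suc c - ?d) + ?d" using that le by simp
        then have "(of_nat W :: 'a) = 2 * of_nat (Suc c - ?d) + of_nat ?d"
          by (metis of_nat_add of_nat_mult of_nat_numeral)
        then show ?thesis using two by (simp add: add_divide_distrib)
      qed
      then show ?thesis using le co f by auto
    next
      case False
      have "\<kappa> = 0" if "2 * c = W + e"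
      proof (rule ccontr)
        assume "\<kappa> \<noteq> 0"
        then obtain c' where "2 * c' + ?d = W" using r True by (auto simp: leading_def)
        then show False using that False by linarith
      qed
      then show ?thesis using False by simp
    qed
    finally show ?thesis using True by simp
  qed
qed

lemma leading_curve_deriv_iter:
  fixes f :: "'a::field poly"
  assumes f: "degree f = e + 2" "coeff f (e + 2) = 1" and two: "(2 :: 'a) \<noteq> 0"
    and r: "leading (e + 2) \<sigma> r W \<kappa>"
  shows "leading (e + 2) (\<sigma> \<noteq> odd j) (curve_deriv_iter f \<sigma> j r) (W + j * e)
    ((\<Prod>l<j. of_nat (W + l * e) / 2) * \<kappa>)"
proof (induction j)
  case 0
  then show ?case using r by simp
next
  case (Suc j)
  have "(\<not> (\<sigma> \<noteq> odd j)) = (\<sigma> \<noteq> odd (Suc j))" by auto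
  then show ?case
    using leading_curve_deriv[OF f two Suc.IH] by (simp add: mult_ac add_ac)
qed

section \<open>Functions vanishing to high order on the diagonal\<close>

text \<open>
  The polynomials \<open>q j\<close> for \<open>j < n\<close> span all polynomials of degree below \<open>n\<close>. Hence the weights \<open>v\<close> are orthogonal to
  the polynomial that vanishes at all the points but one.
\<close>

lemma generalized_vandermonde:
  fixes q :: "nat \<Rightarrow> 'a::field poly"
  assumes S: "finite S" "inj_on x S" "card S \<le> n"
    and q: "\<And>j. j < n \<Longrightarrow> degree (q j) = j" "\<And>j. j < n \<Longrightarrow> coeff (q j) j \<noteq> 0"
    and zero: "\<And>j. j < n \<Longrightarrow> (\<Sum>k\<in>S. v k * poly (q j) (x k)) = 0"
    and k: "k \<in> S"
  shows "v k = 0"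
proof -
  have all: "(\<Sum>k\<in>S. v k * poly r (x k)) = 0" if "m \<le> n" "\<forall>c\<ge>m. coeff r c = 0" for m r
    using that
  proof (induction m arbitrary: r)
    case 0
    then have "r = 0" by (intro poly_eqI) simp
    then show ?case by simp
  next
    case (Suc m)
    define c where "c = coeff r m / coeff (q m) m"
    \<comment> \<open>Cancel the coefficient of degree \<open>m\<close> against \<open>q m\<close>.\<close>
    let ?r = "r - smult c (q m)"
    have m: "m < n" using Suc.prems by simp
    have "coeff ?r i = 0" if "m \<le> i" for i
    proof (cases "i = m")
      case True
      then show ?thesis using q(2)[OF m] by (simp add: c_def)
    next
      case False
      then show ?thesis using that Suc.prems(2) q(1)[OF m] by (simp add: coeff_eq_0)
    qed
    then have "(\<Sum>k\<in>S. v k * poly ?r (x k)) = 0" using m by (intro Suc.IH) auto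
    moreover have "(\<Sum>k\<in>S. v k * poly ?r (x k))
      = (\<Sum>k\<in>S. v k * poly r (x k)) - c * (\<Sum>k\<in>S. v k * poly (q m) (x k))"
      by (simp add: algebra_simps sum_subtractf sum_distrib_left)
    ultimately show ?case using zero[OF m] by simp
  qed
  define r where "r = (\<Prod>k'\<in>S - {k}. [:- x k', 1:])"
  have "degree r = card (S - {k})"
    unfolding r_def by (subst degree_prod_eq_sum_degree) auto
  also have "\<dots> < n" using S k by (metis card_Diff1_less order_less_le_trans)
  finally have "(\<Sum>k'\<in>S. v k' * poly r (x k')) = 0"
    by (intro all[of n]) (auto intro: coeff_eq_0)
  also have "(\<Sum>k'\<in>S. v k' * poly r (x k')) = (\<Sum>k'\<in>{k}. v k' * poly r (x k'))"
  proof (rule sum.mono_neutral_right)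
    show "\<forall>i\<in>S - {k}. v i * poly r (x i) = 0"
    proof
      fix i assume "i \<in> S - {k}"
      then have "poly r (x i) = 0" using S(1) by (auto simp: r_def poly_prod)
      then show "v i * poly r (x i) = 0" by simp
    qed
  qed (use S k in auto)
  finally have "v k * poly r (x k) = 0" by simp
  moreover have "poly r (x k) \<noteq> 0"
    using S k by (auto simp: r_def poly_prod inj_on_def)
  ultimately show ?thesis by simp
qed

lemma of_nat_mod_ring_inj:
  assumes "x < CARD('p::prime_card)" and "y < CARD('p)" and "(of_nat x :: 'p mod_ring) = of_nat y"
  shows "x = y"
proof -
  have main: "x = y" if "x \<le> y" "y < CARD('p)" "(of_nat x :: 'p mod_ring) = of_nat y" for x y
  proof -
    have "(of_nat (y - x) :: 'p mod_ring) = 0" using that by (simp add: of_nat_diff)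
    then have "CARD('p) dvd y - x" by (simp only: mod_ring_of_nat_eq_0_iff)
    then show ?thesis using that by (metis diff_is_0_eq dvd_imp_le le_antisym less_imp_diff_less not_le zero_less_iff_neq_zero)
  qed
  show ?thesis using main[of x y] main[of y x] assms by (metis nat_le_linear)
qed

text \<open>
  The triple \<open>(\<sigma>, i, b)\<close> stands for the function \<open>x^i y^\<sigma> z^b w^\<sigma>\<close> on the square of the curve \<open>y\<^sup>2 = f x\<close>, where \<open>f\<close> has degree \<open>2 g + 1\<close>. With
  \<open>p = 2 q + 1\<close> these are the functions of this form whose pole orders are at most \<open>A = 2 q = p - 1\<close> in \<open>(x, y)\<close> and at most
  \<open>B = m + 2 g - 1\<close> in \<open>(z, w)\<close>. Taking the same exponent \<open>\<sigma>\<close> in both factors restricts to functions that are invariant under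
  the simultaneous change of sign of \<open>y\<close> and \<open>w\<close>; this halves the conditions, and a little less than half
  of the unknowns is lost.
\<close>

definition unknowns :: "nat \<Rightarrow> nat \<Rightarrow> nat \<Rightarrow> (bool \<times> nat \<times> nat) set" where
  "unknowns q g m = {False} \<times> {..q} \<times> {..(m - 1) div 2 + g} \<union> {True} \<times> {..<q - g} \<times> {..<m div 2}"

text \<open>
  The pair \<open>(j, c)\<close> stands for the coefficient of \<open>x^c\<close> in the \<open>j\<close>-th derivative on the diagonal. The pole orders
  that are taken into account grow by \<open>2 g - 2\<close> with each derivative, not by \<open>2 g - 1\<close>.
\<close>

definition conditions :: "nat \<Rightarrow> nat \<Rightarrow> nat \<Rightarrow> (nat \<times> nat) set" where
  "conditions q g m = (SIGMA j:{..<m}.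
     {c. 2 * c + of_bool (odd j) * (2 * g + 1) \<le> 2 * q + (m + 2 * g - 1) + j * (2 * g - 2)})"

lemma finite_unknowns: "finite (unknowns q g m)"
  by (simp add: unknowns_def)

lemma atMost_half: "{c::nat. 2 * c \<le> W} = {..W div 2}"
  by auto

lemma atMost_half_shift: "x \<le> W \<Longrightarrow> {c::nat. 2 * c + x \<le> W} = {..(W - x) div 2}"
  by auto

lemma finite_double_shift_le: "finite {c::nat. 2 * c + x \<le> W}"
  by (rule finite_subset[of _ "{..W}"]) auto

lemma finite_conditions: "finite (conditions q g m)"
  unfolding conditions_def
  by (intro finite_SigmaI finite_lessThan finite_double_shift_le)

lemma card_unknowns:
  "card (unknowns q g m) = Suc q * Suc ((m - 1) div 2 + g) + (q - g) * (m div 2)"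
  unfolding unknowns_def by (subst card_Un_disjoint) (auto simp: card_cartesian_product)

lemma card_conditions:
  assumes "0 < g"
  shows "card (conditions q g m)
    = (\<Sum>j<m. q + j * (g - 1) + (if even j then Suc ((m + 2 * g - 1) div 2) else m div 2))"
proof -
  have "card {c. 2 * c + of_bool (odd j) * (2 * g + 1) \<le> 2 * q + (m + 2 * g - 1) + j * (2 * g - 2)}
    = q + j * (g - 1) + (if even j then Suc ((m + 2 * g - 1) div 2) else m div 2)" if j: "j < m" for j
  proof -
    have jg: "j * (2 * g - 2) = 2 * (j * (g - 1))" by (simp add: diff_mult_distrib2)
    show ?thesis
    proof (cases "even j")
      case True
      then show ?thesis unfolding jg by (simp add: atMost_half) 
    next
      case False
      then have "2 \<le> m" using j by (cases j) auto
      then have "(2 * q + (m + 2 * g - 1) + 2 * (j * (g - 1)) - (2 * g + 1)) div 2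
        = q + j * (g - 1) + (m - 2) div 2"
        using assms by (simp add: algebra_simps)
      moreover have "Suc ((m - 2) div 2) = m div 2" using \<open>2 \<le> m\<close> by presburger
      moreover have "2 * g + 1 \<le> 2 * q + (m + 2 * g - 1) + 2 * (j * (g - 1))"
        using \<open>2 \<le> m\<close> by simp
      ultimately have "card {c. 2 * c + (2 * g + 1) \<le> 2 * q + (m + 2 * g - 1) + 2 * (j * (g - 1))}
        = q + j * (g - 1) + m div 2"
        by (metis add_Suc_right atMost_half_shift card_atMost)
      then show ?thesis using False unfolding jg by simp
    qed
  qed
  then show ?thesis
    unfolding conditions_def
    by (subst card_SigmaI) (auto simp only: finite_lessThan finite_double_shift_le intro!: sum.cong)
qed

lemma alternating_progression_sum:
  fixes q s t g :: nat
  defines "K \<equiv> \<lambda>j. q + j * g + (if even j then s else t)"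
  shows "(\<Sum>j<2 * n. K j) + g * n = n * (2 * q + s + t) + 2 * g * n\<^sup>2"
  by (induction n) (simp_all add: K_def algebra_simps power2_eq_square)

text \<open>
  The number of unknowns exceeds that of conditions by \<open>g (1 + q - n - 2 n\<^sup>2)\<close> if \<open>m = 2 n\<close>, and by
  \<open>g (q - 3 n - 2 n\<^sup>2)\<close> if \<open>m = 2 n + 1\<close>. By parity the assumption \<open>m\<^sup>2 + m < p\<close>
  makes this positive.
\<close>

lemma card_conditions_less_card_unknowns:
  assumes g: "0 < g" "g \<le> q" and m: "0 < m" "m\<^sup>2 + m < 2 * q + 1"
  shows "card (conditions q g m) < card (unknowns q g m)"
proof -
  define K where "K j = q + j * (g - 1) + (if even j then Suc ((m + 2 * g - 1) div 2) else m div 2)" for j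
  have cK: "card (conditions q g m) = (\<Sum>j<m. K j)" unfolding K_def using card_conditions[OF g(1)] .
  note sumK = alternating_progression_sum[of q "g - 1" "Suc ((m + 2 * g - 1) div 2)" "m div 2", folded K_def]
  obtain h where h: "g = Suc h" using g by (cases g) auto
  obtain r where r: "q = Suc (h + r)" using g h by (metis le_Suc_ex plus_nat.simps(2))
  consider n where "m = 2 * n" "0 < n" | n where "m = 2 * n + 1"
    using m(1) by (cases "even m") (auto elim!: evenE oddE)
  then show ?thesis
  proof cases
    case 1
    then obtain n' where n': "n = Suc n'" by (cases n) auto
    have le: "2 * n\<^sup>2 + n \<le> q" using m(2) 1 by (simp add: power2_eq_square)
    have "(\<Sum>j<m. K j) + h * n = n * (2 * q + (n + h + 1) + n) + 2 * h * n\<^sup>2"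
      using sumK[of n] 1 h by simp
    moreover have "card (unknowns q g m) = Suc q * (n + h + 1) + r * n"
      unfolding card_unknowns using 1 h r n' by simp
    moreover have "n * (2 * q + (n + h + 1) + n) + 2 * h * n\<^sup>2 < Suc q * (n + h + 1) + r * n + h * n"
    proof -
      have "0 < (int h + 1) * (1 + int q - int n - 2 * (int n)\<^sup>2)"
        using le by (intro mult_pos_pos) (auto simp flip: of_nat_power)
      also have "\<dots> = int (Suc q * (n + h + 1) + r * n + h * n) - int (n * (2 * q + (n + h + 1) + n) + 2 * h * n\<^sup>2)"
        unfolding r by (simp add: algebra_simps power2_eq_square)
      finally show ?thesis by linarith
    qed
    ultimately show ?thesis unfolding cK by linarith
  next
    case 2
    have le: "2 * n\<^sup>2 + 3 * n + 1 \<le> q" using m(2) 2 by (simp add: power2_eq_square algebra_simps)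
    have "(\<Sum>j<m. K j) + h * n = n * (2 * q + (n + h + 2) + n) + 2 * h * n\<^sup>2 + (q + 2 * n * h + (n + h + 2))"
      using sumK[of n] 2 h by (simp add: K_def)
    moreover have "card (unknowns q g m) = Suc q * (n + h + 2) + r * n"
      unfolding card_unknowns using 2 h r by simp
    moreover have "n * (2 * q + (n + h + 2) + n) + 2 * h * n\<^sup>2 + (q + 2 * n * h + (n + h + 2))
      < Suc q * (n + h + 2) + r * n + h * n"
    proof -
      have "0 < (int h + 1) * (int q - 3 * int n - 2 * (int n)\<^sup>2)"
        using le by (intro mult_pos_pos) (auto simp flip: of_nat_power)
      also have "\<dots> = int (Suc q * (n + h + 2) + r * n + h * n)
        - int (n * (2 * q + (n + h + 2) + n) + 2 * h * n\<^sup>2 + (q + 2 * n * h + (n + h + 2)))"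
        unfolding r by (simp add: algebra_simps power2_eq_square)
      finally show ?thesis by linarith
    qed
    ultimately show ?thesis unfolding cK by linarith
  qed
qed

text \<open>
  The pole order at infinity in \<open>(x, y)\<close>; the one in \<open>(z, w)\<close> is \<open>right_weight\<close>.
\<close>

fun left_weight :: "nat \<Rightarrow> bool \<times> nat \<times> nat \<Rightarrow> nat" where
  "left_weight d (\<sigma>, i, b) = 2 * i + of_bool \<sigma> * d"

fun right_weight :: "nat \<Rightarrow> bool \<times> nat \<times> nat \<Rightarrow> nat" where
  "right_weight d (\<sigma>, i, b) = 2 * b + of_bool \<sigma> * d"

text \<open>
  The \<open>j\<close>-th derivative, in the first variables only, of \<open>x^i y^\<sigma> z^b w^\<sigma>\<close>, restricted to the diagonal \<open>z = x\<close>,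
  \<open>w = y\<close>. It is a polynomial for even \<open>j\<close> and a polynomial times \<open>y\<close> for odd \<open>j\<close>; in the latter case
  the factor \<open>y\<close> is dropped. Two factors \<open>y\<close> meet, and give \<open>f\<close>, when \<open>\<sigma>\<close> holds and \<open>j\<close> is even.
\<close>

fun diagonal_deriv_term :: "'a::field poly \<Rightarrow> nat \<Rightarrow> bool \<times> nat \<times> nat \<Rightarrow> 'a poly" where
  "diagonal_deriv_term f j (\<sigma>, i, b)
    = (if \<sigma> \<and> even j then f else 1) * curve_deriv_iter f \<sigma> j (monom 1 i) * monom 1 b"

lemma weights_inj:
  assumes "odd d" "left_weight d k = left_weight d k'" "right_weight d k = right_weight d k'"
  shows "k = k'"
proof -
  obtain \<sigma> i b \<tau> i' b' where k: "k = (\<sigma>, i, b)" "k' = (\<tau>, i', b')" by (metis prod_cases3)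
  have "odd (left_weight d k) = \<sigma>" "odd (left_weight d k') = \<tau>"
    using assms(1) by (auto simp: k)
  then have "\<sigma> = \<tau>" using assms(2) by simp
  then show ?thesis using assms k by simp
qed

lemma unknowns_weights:
  assumes "k \<in> unknowns q g m" "g \<le> q" "0 < m"
  shows "left_weight (2 * g + 1) k \<le> 2 * q" "right_weight (2 * g + 1) k \<le> m + 2 * g - 1"
  using assms by (auto simp: unknowns_def)

lemma leading_diagonal_deriv_term:
  fixes f :: "'a::field poly"
  assumes f: "degree f = e + 2" "coeff f (e + 2) = 1" and two: "(2 :: 'a) \<noteq> 0"
  shows "leading (e + 2) (odd j) (diagonal_deriv_term f j k)
    (left_weight (e + 2) k + right_weight (e + 2) k + j * e)
    (\<Prod>l<j. of_nat (left_weight (e + 2) k + l * e) / 2)"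
proof -
  obtain \<sigma> i b where k: "k = (\<sigma>, i, b)" by (metis prod_cases3)
  let ?r = "curve_deriv_iter f \<sigma> j (monom 1 i)"
  let ?W = "left_weight (e + 2) k + j * e"
  let ?\<kappa> = "\<Prod>l<j. of_nat (left_weight (e + 2) k + l * e) / 2 :: 'a"
  have r: "leading (e + 2) (\<sigma> \<noteq> odd j) ?r ?W ?\<kappa>"
    using leading_curve_deriv_iter[OF f two leading_monom, of \<sigma> j i] by (simp add: k)
  consider "\<not> \<sigma>" | "\<sigma>" "even j" | "\<sigma>" "odd j" by blast
  then have "leading (e + 2) (odd j) ((if \<sigma> \<and> even j then f else 1) * ?r) (?W + of_bool \<sigma> * (e + 2)) ?\<kappa>"
  proof cases
    case 1
    then show ?thesis using r by simp
  next
    case 2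
    then show ?thesis using leading_mult_curve[OF f] r by simp
  next
    case 3
    then show ?thesis using leading_retype r by fastforce
  qed
  from leading_mult_monom[OF this, of b] show ?thesis by (simp add: k add_ac)
qed

definition diagonal_deriv :: "'a::field poly \<Rightarrow> (bool \<times> nat \<times> nat) set \<Rightarrow> (bool \<times> nat \<times> nat \<Rightarrow> 'a) \<Rightarrow> nat \<Rightarrow> 'a poly" where
  "diagonal_deriv f I v j = (\<Sum>k\<in>I. smult (v k) (diagonal_deriv_term f j k))"

text \<open>
  Let \<open>w\<close> be the largest total pole order that occurs. The leading coefficient of the \<open>j\<close>-th derivative on the diagonal is
  a sum over the terms of total order \<open>w\<close>, in which \<open>v k\<close> is multiplied by a polynomial of degree \<open>j\<close> in the
  left weight of \<open>k\<close>. If it vanishes for all \<open>j < n\<close>, there must be more than \<open>n\<close> such terms. But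
  the left weight determines the term and lies between \<open>w - B\<close> and \<open>A\<close>. The bound \<open>A < p\<close> keeps these weights distinct in the field.
\<close>

lemma support_shrinks:
  fixes f :: "'p::prime_card mod_ring poly"
  assumes p: "2 < CARD('p)"
    and f: "degree f = e + 2" "coeff f (e + 2) = 1" "odd e"
    and I: "finite I" "\<And>k. k \<in> I \<Longrightarrow> left_weight (e + 2) k \<le> A" "\<And>k. k \<in> I \<Longrightarrow> right_weight (e + 2) k \<le> B"
    and A: "A < CARD('p)"
    and zero: "\<And>j. j < n \<Longrightarrow> diagonal_deriv f I v j = 0"
    and k: "k \<in> I" "v k \<noteq> 0"
  shows "left_weight (e + 2) k + right_weight (e + 2) k + n \<le> A + B"
proof (rule ccontr)
  let ?d = "e + 2"
  let ?wt = "\<lambda>k. left_weight ?d k + right_weight ?d k"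
  note two = mod_ring_two_neq_0[OF p]
  assume large: "\<not> ?thesis"
  define Bad where "Bad = {k \<in> I. v k \<noteq> 0}"
  define w where "w = Max (?wt ` Bad)"
  \<comment> \<open>Terms of maximal total pole order; only they contribute to the leading coefficient.\<close>
  define Top where "Top = {k \<in> Bad. ?wt k = w}"
  define \<kappa> where "\<kappa> j k = (\<Prod>l<j. of_nat (left_weight ?d k + l * e) / 2 :: 'p mod_ring)" for j k
  have fin: "finite Bad" using I(1) by (simp add: Bad_def)
  have kBad: "k \<in> Bad" using k by (simp add: Bad_def)
  have w_ge: "?wt k' \<le> w" if "k' \<in> Bad" for k'
    unfolding w_def using fin that by (intro Max_ge) auto
  have "w \<in> ?wt ` Bad" unfolding w_def using fin kBad by (intro Max_in) auto
  then obtain k0 where "w = ?wt k0" "k0 \<in> Bad" by (rule imageE)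
  then have Top_ne: "Top \<noteq> {}" unfolding Top_def by blast
  have w_large: "A + B < w + n" using w_ge[OF kBad] large by simp
  have sum0: "(\<Sum>k\<in>Top. v k * \<kappa> j k) = 0" if j: "j < n" for j
  proof -
    have "leading ?d (odd j) (diagonal_deriv f I v j) (w + j * e) (\<Sum>k\<in>I. if k \<in> Top then v k * \<kappa> j k else 0)"
      unfolding diagonal_deriv_def
    proof (rule leading_sum)
      fix k' assume k': "k' \<in> I"
      have l: "leading ?d (odd j) (smult (v k') (diagonal_deriv_term f j k')) (?wt k' + j * e) (v k' * \<kappa> j k')"
        unfolding \<kappa>_def by (intro leading_smult leading_diagonal_deriv_term f two)
      consider "v k' = 0" | "k' \<in> Top" | "k' \<in> Bad" "?wt k' < w"
        using k' w_ge[of k'] by (auto simp: Top_def Bad_def order_le_less)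
      then show "leading ?d (odd j) (smult (v k') (diagonal_deriv_term f j k')) (w + j * e)
        (if k' \<in> Top then v k' * \<kappa> j k' else 0)"
      proof cases
        case 1
        then show ?thesis by (simp add: leading_0 Top_def Bad_def)
      next
        case 2
        then show ?thesis using l by (simp add: Top_def)
      next
        case 3
        then show ?thesis using leading_less[OF l, of "w + j * e"] by (simp add: Top_def)
      qed
    qed
    then have "(\<Sum>k\<in>I. if k \<in> Top then v k * \<kappa> j k else 0) = 0"
      unfolding zero[OF j] by (rule leading_of_0)
    moreover have "I \<inter> Top = Top" by (auto simp: Top_def Bad_def)
    ultimately show ?thesis using I(1) by (simp add: sum.inter_restrict[symmetric])
  qed
  define x where "x k = (of_nat (left_weight ?d k) :: 'p mod_ring)" for k
  have left_inj: "inj_on (left_weight ?d) Top"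
  proof (rule inj_onI)
    fix k1 k2 assume h: "k1 \<in> Top" "k2 \<in> Top" "left_weight ?d k1 = left_weight ?d k2"
    then have "right_weight ?d k1 = right_weight ?d k2" by (simp add: Top_def)
    then show "k1 = k2" using weights_inj[of ?d k1 k2] h f(3) by simp
  qed
  have x_inj: "inj_on x Top"
  proof (rule inj_onI)
    fix k1 k2 assume h: "k1 \<in> Top" "k2 \<in> Top" "x k1 = x k2"
    have "left_weight ?d k1 < CARD('p)" "left_weight ?d k2 < CARD('p)"
      using h I(2)[of k1] I(2)[of k2] A unfolding Top_def Bad_def by (blast intro: le_less_trans)+
    then have "left_weight ?d k1 = left_weight ?d k2"
      using h(3) of_nat_mod_ring_inj unfolding x_def by blast
    then show "k1 = k2" using left_inj h by (auto dest: inj_onD)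
  qed
  have "left_weight ?d ` Top \<subseteq> {w - B..A}"
  proof
    fix a assume "a \<in> left_weight ?d ` Top"
    then obtain k' where "k' \<in> I" "?wt k' = w" "a = left_weight ?d k'" by (auto simp: Top_def Bad_def)
    then show "a \<in> {w - B..A}" using I(2)[of k'] I(3)[of k'] by auto
  qed
  then have "card (left_weight ?d ` Top) \<le> card {w - B..A}" by (rule card_mono[rotated]) simp
  also have "\<dots> \<le> n" using w_large by simp
  finally have card_Top: "card Top \<le> n" using left_inj by (simp add: card_image)
  \<comment> \<open>The factor \<open>\<kappa> j k\<close> is a polynomial of degree \<open>j\<close>, evaluated at the left weight.\<close>
  define Q where "Q j = (\<Prod>l<j. [:of_nat (l * e) / 2, 1 / 2:] :: 'p mod_ring poly)" for j
  have degQ: "degree (Q j) = j" for j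
    unfolding Q_def using two by (subst degree_prod_eq_sum_degree) auto
  have "Q j \<noteq> 0" for j unfolding Q_def using two by auto
  then have lcQ: "coeff (Q j) j \<noteq> 0" for j using degQ[of j] by (metis leading_coeff_0_iff)
  have polyQ: "poly (Q j) (x k) = \<kappa> j k" for j k
    unfolding Q_def \<kappa>_def x_def poly_prod
    by (rule prod.cong) (simp_all add: add_divide_distrib)
  obtain k' where k': "k' \<in> Top" using Top_ne by blast
  have "v k' = 0"
  proof (rule generalized_vandermonde[where q = Q and n = n and x = x and S = Top])
    show "finite Top" using fin by (simp add: Top_def)
  qed (use x_inj card_Top degQ lcQ sum0 k' polyQ in auto)
  then show False using k' by (simp add: Top_def Bad_def)
qed

text \<open>
  Once the derivatives of order less than \<open>j\<close> vanish, the support has shrunk so far that the coefficients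
  of the \<open>j\<close>-th derivative outside the range of the conditions vanish by themselves.
\<close>

lemma diagonal_deriv_eq_0:
  fixes f :: "'p::prime_card mod_ring poly"
  assumes p: "2 < CARD('p)"
    and f: "degree f = e + 2" "coeff f (e + 2) = 1" "odd e"
    and I: "finite I" "\<And>k. k \<in> I \<Longrightarrow> left_weight (e + 2) k \<le> A" "\<And>k. k \<in> I \<Longrightarrow> right_weight (e + 2) k \<le> B"
    and A: "A < CARD('p)"
    and cond: "\<And>j c. j < m \<Longrightarrow> 2 * c + of_bool (odd j) * (e + 2) \<le> A + B + j * (e - 1) \<Longrightarrow> coeff (diagonal_deriv f I v j) c = 0"
    and j: "j < m"
  shows "diagonal_deriv f I v j = 0"
  using j
proof (induction j rule: less_induct)
  case (less j)
  show ?case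
  proof (rule poly_eqI)
    fix c
    show "coeff (diagonal_deriv f I v j) c = coeff 0 c"
    proof (cases "2 * c + of_bool (odd j) * (e + 2) \<le> A + B + j * (e - 1)")
      case True
      then show ?thesis using cond less.prems by simp
    next
      case False
      have "coeff (smult (v k) (diagonal_deriv_term f j k)) c = 0" if k: "k \<in> I" for k
      proof (cases "v k = 0")
        case nz: False
        have "left_weight (e + 2) k + right_weight (e + 2) k + j \<le> A + B"
          using less by (intro support_shrinks[OF p f I A, where n = j and k = k and v = v] k nz) auto
        moreover have "j * e = j * (e - 1) + j" using f(3) by (cases e) auto
        ultimately have "left_weight (e + 2) k + right_weight (e + 2) k + j * e < 2 * c + of_bool (odd j) * (e + 2)"
          using False by linarith
        then show ?thesis
          using leading_coeff_above_eq_0[OF leading_diagonal_deriv_term[OF f(1,2) mod_ring_two_neq_0[OF p]]] by simp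
      qed simp
      then show ?thesis unfolding diagonal_deriv_def coeff_sum coeff_0 by (intro sum.neutral ballI)
    qed
  qed
qed

section \<open>Orders of vanishing at rational points\<close>

definition exact_order :: "'a::field poly \<Rightarrow> 'a \<Rightarrow> nat \<Rightarrow> bool" where
  "exact_order r x n \<longleftrightarrow> (\<exists>w. r = [:- x, 1:] ^ n * w \<and> poly w x \<noteq> 0)"

lemma exact_order_order: "r \<noteq> 0 \<Longrightarrow> exact_order r x (order x r)"
  unfolding exact_order_def using order_decomp[of r x] by (auto simp: poly_eq_0_iff_dvd)

lemma exact_order_0_poly: "exact_order r x 0 \<Longrightarrow> poly r x \<noteq> 0"
  by (auto simp: exact_order_def)

lemma pderiv_power_linear_mult:
  "pderiv ([:- x, 1:] ^ Suc n * w)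
    = [:- x, 1:] ^ n * (smult (of_nat (Suc n)) w + [:- x, 1:] * pderiv w)" for x :: "'a::field"
proof -
  have "pderiv [:- x, 1:] = 1" by (simp add: pderiv_pCons)
  then show ?thesis
    unfolding pderiv_mult pderiv_power_Suc by (simp only: mult_1_right) (simp add: algebra_simps)
qed

lemma exact_order_curve_deriv:
  assumes r: "exact_order r x (Suc n)" and n: "of_nat (Suc n) \<noteq> (0 :: 'a::field)"
    and f: "\<sigma> \<Longrightarrow> poly f x \<noteq> (0 :: 'a)"
  shows "exact_order (curve_deriv f \<sigma> r) x n"
proof -
  obtain w where w: "r = [:- x, 1:] ^ Suc n * w" "poly w x \<noteq> 0" using r by (auto simp: exact_order_def)
  let ?w = "smult (of_nat (Suc n)) w + [:- x, 1:] * pderiv w"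
  have d: "pderiv r = [:- x, 1:] ^ n * ?w" unfolding w(1) by (rule pderiv_power_linear_mult)
  have w': "poly ?w x \<noteq> 0" using w(2) n by (simp del: of_nat_Suc)
  show ?thesis
  proof (cases \<sigma>)
    case False
    then show ?thesis unfolding exact_order_def curve_deriv_def using d w' by auto
  next
    case True
    have distrib: "f * (t ^ n * ?w) + smult c (pderiv f * (t ^ Suc n * w))
      = t ^ n * (f * ?w + t * smult c (pderiv f * w))" for t c
      by (simp add: distrib_left mult_ac)
    have "curve_deriv f True r = f * ([:- x, 1:] ^ n * ?w) + smult (1 / 2) (pderiv f * r)"
      by (simp only: curve_deriv_def d if_True)
    also have "\<dots> = [:- x, 1:] ^ n * (f * ?w + [:- x, 1:] * smult (1 / 2) (pderiv f * w))"
      unfolding w(1) by (rule distrib)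
    finally have "curve_deriv f True r
      = [:- x, 1:] ^ n * (f * ?w + [:- x, 1:] * smult (1 / 2) (pderiv f * w))" .
    moreover have "poly (f * ?w + [:- x, 1:] * smult (1 / 2) (pderiv f * w)) x \<noteq> 0"
      using w' f[OF True] by simp
    ultimately have "exact_order (curve_deriv f True r) x n" unfolding exact_order_def by blast
    then show ?thesis using True by simp
  qed
qed

text \<open>
  At a branch point \<open>y\<close> is a local parameter and \<open>x\<close> has order \<open>2\<close>. The derivation lowers the order \<open>2 n + 1\<close> of \<open>r y\<close> to \<open>2 n\<close>,
  which is order \<open>n\<close> again in terms of \<open>x\<close>.
\<close>

lemma exact_order_curve_deriv_root:
  fixes x :: "'a::field"
  assumes r: "exact_order r x n" and n: "of_nat (2 * n + 1) \<noteq> (0 :: 'a)" and two: "(2 :: 'a) \<noteq> 0"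
    and f: "f = [:- x, 1:] * u" "poly u x \<noteq> 0"
  shows "exact_order (curve_deriv f True r) x n"
proof -
  obtain w where w: "r = [:- x, 1:] ^ n * w" "poly w x \<noteq> 0" using r by (auto simp: exact_order_def)
  have df: "pderiv f = u + [:- x, 1:] * pderiv u"
    unfolding f(1) pderiv_mult by (simp add: pderiv_pCons add.commute)
  have fd: "f * pderiv r = [:- x, 1:] ^ n * (smult (of_nat n) (u * w) + [:- x, 1:] * (u * pderiv w))"
  proof (cases n)
    case 0
    then show ?thesis using w f by (simp only: power_0 mult_1_left of_nat_0 smult_0_left add_0 mult.assoc)
  next
    case (Suc k)
    have "pderiv r = [:- x, 1:] ^ k * (smult (of_nat n) w + [:- x, 1:] * pderiv w)"
      unfolding w(1) Suc by (rule pderiv_power_linear_mult)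
    then have "f * pderiv r = ([:- x, 1:] * [:- x, 1:] ^ k) * (u * (smult (of_nat n) w + [:- x, 1:] * pderiv w))"
      using f(1) by (simp only: mult_ac)
    also have "\<dots> = [:- x, 1:] ^ n * (smult (of_nat n) (u * w) + [:- x, 1:] * (u * pderiv w))"
      by (simp only: Suc power_Suc distrib_left mult_smult_right mult_ac)
    finally show ?thesis .
  qed
  let ?w = "smult (of_nat n) (u * w) + [:- x, 1:] * (u * pderiv w) + smult (1 / 2) ((u + [:- x, 1:] * pderiv u) * w)"
  have "curve_deriv f True r = [:- x, 1:] ^ n * ?w"
    unfolding curve_deriv_def fd df using w(1) by (simp add: distrib_left mult_ac)
  moreover have "poly ?w x = of_nat (2 * n + 1) / 2 * (poly u x * poly w x)"
    using two by (simp add: field_simps)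
  then have "poly ?w x \<noteq> 0" using n f(2) w(2) two by (metis divide_eq_0_iff mult_eq_0_iff)
  ultimately show ?thesis unfolding exact_order_def by blast
qed

lemma mod_ring_of_nat_neq_0:
  "0 < n \<Longrightarrow> n < CARD('p) \<Longrightarrow> (of_nat n :: 'p::prime_card mod_ring) \<noteq> 0"
  using mod_ring_of_nat_eq_0_iff[where 'p='p, of n] by (auto dest: dvd_imp_le)

text \<open>
  Each derivative lowers the order by exactly one as long as the order is nonzero in the field, which
  explains the bound on \<open>m\<close>.
\<close>

lemma order_ge_if_curve_derivs_vanish:
  fixes f :: "'p::prime_card mod_ring poly"
  assumes r: "r \<noteq> 0" and f: "poly f x \<noteq> 0" and m: "m \<le> CARD('p)"
    and zero: "\<And>j. j < m \<Longrightarrow> poly (curve_deriv_iter f False j r) x = 0"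
  shows "m \<le> order x r"
proof (rule ccontr)
  let ?n = "order x r"
  assume "\<not> ?thesis"
  then have lt: "?n < m" by simp
  have "exact_order (curve_deriv_iter f False j r) x (?n - j)" if "j \<le> ?n" for j
    using that
  proof (induction j)
    case 0
    then show ?case using exact_order_order[OF r] by simp
  next
    case (Suc j)
    have s: "?n - j = Suc (?n - Suc j)" using Suc.prems by simp
    have "(of_nat (Suc (?n - Suc j)) :: 'p mod_ring) \<noteq> 0"
      using lt m s by (intro mod_ring_of_nat_neq_0) auto
    then show ?case
      using exact_order_curve_deriv[of _ x "?n - Suc j" _ f] Suc f s by simp
  qed
  from this[of ?n] have "poly (curve_deriv_iter f False ?n r) x \<noteq> 0"
    using exact_order_0_poly by simp
  then show False using zero lt by blast
qed

text \<open>
  At a root of \<open>f\<close> one step lowers the order in \<open>x\<close> by one and the next step keeps it. So vanishing to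
  order \<open>m\<close> on the curve is only \<open>m / 2\<close> in \<open>x\<close>, and only the derivatives of even order give information.
\<close>

lemma order_ge_if_curve_derivs_vanish_root:
  fixes f :: "'p::prime_card mod_ring poly"
  assumes p: "2 < CARD('p)" and r: "r \<noteq> 0" and f: "f = [:- x, 1:] * u" "poly u x \<noteq> 0"
    and m: "m \<le> CARD('p)"
    and zero: "\<And>j. j < m \<Longrightarrow> even j \<Longrightarrow> poly (curve_deriv_iter f False j r) x = 0"
  shows "m \<le> 2 * order x r"
proof (rule ccontr)
  let ?n = "order x r"
  assume "\<not> ?thesis"
  then have lt: "2 * ?n < m" by simp
  have "exact_order (curve_deriv_iter f False (2 * j) r) x (?n - j)" if "j \<le> ?n" for j
    using that
  proof (induction j)
    case 0
    then show ?case using exact_order_order[OF r] by simp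
  next
    case (Suc j)
    let ?k = "?n - Suc j"
    have s: "?n - j = Suc ?k" using Suc.prems by simp
    have n1: "(of_nat (Suc ?k) :: 'p mod_ring) \<noteq> 0"
      using lt m s by (intro mod_ring_of_nat_neq_0) auto
    have n2: "(of_nat (2 * ?k + 1) :: 'p mod_ring) \<noteq> 0"
      using lt m s by (intro mod_ring_of_nat_neq_0) auto
    have "exact_order (curve_deriv f False (curve_deriv_iter f False (2 * j) r)) x ?k"
      using Suc s by (intro exact_order_curve_deriv n1) auto
    then have "exact_order (curve_deriv f True (curve_deriv f False (curve_deriv_iter f False (2 * j) r))) x ?k"
      by (intro exact_order_curve_deriv_root[OF _ n2 mod_ring_two_neq_0[OF p] f])
    then show ?case by simp
  qed
  from this[of ?n] have "poly (curve_deriv_iter f False (2 * ?n) r) x \<noteq> 0"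
    using exact_order_0_poly by simp
  then show False using zero[OF lt] by simp
qed

section \<open>Restriction to the graph of Frobenius\<close>

text \<open>
  The restriction of \<open>x^i y^\<sigma> z^b w^\<sigma>\<close> to \<open>z = x^p\<close>, \<open>w = a y^p\<close>, using \<open>y * y^p = f ^ ((p + 1) / 2)\<close>. The sign \<open>a\<close> selects
  the points over which \<open>f x\<close> is a square (\<open>a = 1\<close>) or a nonresidue (\<open>a = -1\<close>).
\<close>

fun frobenius_term :: "'p::prime_card mod_ring poly \<Rightarrow> 'p mod_ring \<Rightarrow> bool \<times> nat \<times> nat \<Rightarrow> 'p mod_ring poly" where
  "frobenius_term f a (\<sigma>, i, b) = monom 1 i * monom 1 (CARD('p) * b)
     * (if \<sigma> then smult a (f ^ Suc (CARD('p) div 2)) else 1)"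

lemma curve_deriv_iter_frobenius_term:
  fixes f :: "'p::prime_card mod_ring poly"
  assumes p: "2 < CARD('p)"
  shows "curve_deriv_iter f False j (frobenius_term f a (\<sigma>, i, b))
    = curve_deriv_iter f \<sigma> j (monom 1 i) * monom 1 (CARD('p) * b)
      * (if \<sigma> then smult a (f ^ (if odd j then CARD('p) div 2 else Suc (CARD('p) div 2))) else 1)"
proof -
  let ?h = "CARD('p) div 2"
  have const: "pderiv (monom c (CARD('p) * b)) = 0" for c :: "'p mod_ring"
    by (simp add: pderiv_monom)
  show ?thesis
  proof (cases \<sigma>)
    case False
    then show ?thesis using curve_deriv_iter_mult_const[OF const] by simp
  next
    case True
    have "CARD('p) + 1 = 2 * Suc ?h" using odd_prime_card[OF p] by presburger
    then have "2 * (of_nat (Suc ?h) :: 'p mod_ring) = of_nat (CARD('p) + 1)"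
      by (metis of_nat_mult of_nat_numeral)
    also have "\<dots> = 1" by simp
    finally have half: "2 * (of_nat (Suc ?h) :: 'p mod_ring) = 1" .
    have ma: "monom a n = smult a (monom 1 n)" for n by (simp add: smult_monom)
    have "frobenius_term f a (\<sigma>, i, b) = (monom 1 i * f ^ Suc ?h) * monom a (CARD('p) * b)"
      unfolding ma using True by (simp add: mult_ac)
    also have "curve_deriv_iter f False j \<dots>
      = curve_deriv_iter f True j (monom 1 i) * f ^ (if odd j then ?h else Suc ?h) * monom a (CARD('p) * b)"
      unfolding curve_deriv_iter_mult_const[OF const]
        curve_deriv_iter_mult_half_power[OF half mod_ring_two_neq_0[OF p]] ..
    finally show ?thesis using True unfolding ma by (simp add: mult_ac)
  qed
qed

definition frobenius_poly where
  "frobenius_poly f a I v = (\<Sum>k\<in>I. smult (v k) (frobenius_term f a k))"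

text \<open>
  At a rational point the graph of Frobenius meets the diagonal, and \<open>p\<close>-th powers are constants for the derivation. So
  derivatives along the graph agree with the derivatives in the first variables on the diagonal. At a branch
  point this holds for even \<open>j\<close> only, because for odd \<open>j\<close> a factor \<open>y\<close> has been dropped, which vanishes there.
\<close>

lemma poly_curve_deriv_iter_frobenius_poly:
  fixes f :: "'p::prime_card mod_ring poly"
  assumes p: "2 < CARD('p)" and a: "a * a = 1"
    and x: "poly f x ^ (CARD('p) div 2) = a \<or> poly f x = 0 \<and> even j"
  shows "poly (curve_deriv_iter f False j (frobenius_poly f a I v)) x = poly (diagonal_deriv f I v j) x"
proof -
  let ?h = "CARD('p) div 2"
  have "poly (curve_deriv_iter f False j (frobenius_term f a k)) x = poly (diagonal_deriv_term f j k) x" for k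
  proof -
    obtain \<sigma> i b where k: "k = (\<sigma>, i, b)" by (metis prod_cases3)
    have fr: "x ^ (CARD('p) * b) = x ^ b" by (simp add: power_mult mod_ring_fermat)
    define E where "E = (if odd j then ?h else Suc ?h)"
    have fx: "a * poly f x ^ E = (if even j then poly f x else 1)"
      unfolding E_def using x a by (auto simp: mult_ac)
    have "poly (curve_deriv_iter f False j (frobenius_term f a k)) x
      = poly (curve_deriv_iter f \<sigma> j (monom 1 i)) x * x ^ b * (if \<sigma> then a * poly f x ^ E else 1)"
      unfolding k curve_deriv_iter_frobenius_term[OF p] E_def[symmetric] by (simp add: poly_monom fr)
    then show ?thesis unfolding fx by (simp add: k poly_monom mult_ac)
  qed
  then show ?thesis
    by (simp add: frobenius_poly_def diagonal_deriv_def curve_deriv_iter_sum curve_deriv_iter_smult poly_sum)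
qed

lemma degree_frobenius_term:
  fixes f :: "'p::prime_card mod_ring poly"
  assumes p: "2 < CARD('p)" and a: "a \<noteq> 0" and f: "degree f = d" "f \<noteq> 0"
  shows "2 * degree (frobenius_term f a k) = left_weight d k + CARD('p) * right_weight d k"
    and "frobenius_term f a k \<noteq> 0"
proof -
  obtain \<sigma> i b where k: "k = (\<sigma>, i, b)" by (metis prod_cases3)
  have h: "2 * Suc (CARD('p) div 2) = CARD('p) + 1" using odd_prime_card[OF p] by presburger
  have nz: "monom (1 :: 'p mod_ring) n \<noteq> 0" for n by simp
  show "frobenius_term f a k \<noteq> 0" using a f by (simp add: k)
  have "degree (frobenius_term f a k) = i + CARD('p) * b + of_bool \<sigma> * (Suc (CARD('p) div 2) * d)"
    using a f by (simp add: k degree_mult_eq degree_monom_eq degree_power_eq)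
  then have "2 * degree (frobenius_term f a k) = 2 * i + 2 * (CARD('p) * b) + of_bool \<sigma> * (2 * Suc (CARD('p) div 2) * d)"
    by (simp only: distrib_left mult_ac)
  then show "2 * degree (frobenius_term f a k) = left_weight d k + CARD('p) * right_weight d k"
    unfolding h k by (simp add: algebra_simps)
qed

lemma sum_distinct_degrees_neq_0:
  fixes T :: "'k \<Rightarrow> 'a::field poly"
  assumes I: "finite I" and inj: "inj_on (\<lambda>k. degree (T k)) I" and T: "\<And>k. k \<in> I \<Longrightarrow> T k \<noteq> 0"
    and v: "\<exists>k\<in>I. v k \<noteq> 0"
  shows "(\<Sum>k\<in>I. smult (v k) (T k)) \<noteq> 0"
proof
  assume 0: "(\<Sum>k\<in>I. smult (v k) (T k)) = 0"
  let ?J = "{k \<in> I. v k \<noteq> 0}"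
  have J: "finite ?J" "?J \<noteq> {}" using I v by auto
  then have "Max ((\<lambda>k. degree (T k)) ` ?J) \<in> (\<lambda>k. degree (T k)) ` ?J" by (intro Max_in) auto
  then obtain k where "k \<in> ?J" and "Max ((\<lambda>k. degree (T k)) ` ?J) = degree (T k)" by blast
  moreover have "degree (T k') \<le> Max ((\<lambda>k. degree (T k)) ` ?J)" if "k' \<in> ?J" for k'
    using J that by (intro Max_ge) auto
  ultimately have k: "k \<in> ?J" "\<forall>k'\<in>?J. degree (T k') \<le> degree (T k)" by auto
  have "0 = coeff (\<Sum>k\<in>I. smult (v k) (T k)) (degree (T k))" using 0 by simp
  also have "\<dots> = (\<Sum>k'\<in>I. v k' * coeff (T k') (degree (T k)))" by (simp add: coeff_sum)
  also have "\<dots> = (\<Sum>k'\<in>{k}. v k' * coeff (T k') (degree (T k)))"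
  proof (rule sum.mono_neutral_right)
    show "\<forall>k'\<in>I - {k}. v k' * coeff (T k') (degree (T k)) = 0"
    proof
      fix k' assume k': "k' \<in> I - {k}"
      show "v k' * coeff (T k') (degree (T k)) = 0"
      proof (cases "v k' = 0")
        case False
        then have "degree (T k') \<le> degree (T k)" using k k' by auto
        moreover have "degree (T k') \<noteq> degree (T k)" using inj k k' by (auto dest: inj_onD)
        ultimately show ?thesis by (simp add: coeff_eq_0)
      qed simp
    qed
  qed (use I k in auto)
  finally show False using k(1) T by auto
qed

text \<open>
  Twice the degree of a term is \<open>left_weight + p * right_weight\<close>. Since left weights are smaller than \<open>p\<close>, the
  degrees are distinct and no cancellation can occur.
\<close>

lemma frobenius_poly_neq_0:
  fixes f :: "'p::prime_card mod_ring poly"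
  assumes p: "2 < CARD('p)" and a: "a \<noteq> 0" and f: "degree f = d" "f \<noteq> 0" "odd d"
    and I: "finite I" "\<And>k. k \<in> I \<Longrightarrow> left_weight d k < CARD('p)" and v: "\<exists>k\<in>I. v k \<noteq> 0"
  shows "frobenius_poly f a I v \<noteq> 0"
  unfolding frobenius_poly_def
proof (rule sum_distinct_degrees_neq_0[OF I(1) _ _ v])
  show "inj_on (\<lambda>k. degree (frobenius_term f a k)) I"
  proof (rule inj_onI)
    fix k k' assume k: "k \<in> I" "k' \<in> I" "degree (frobenius_term f a k) = degree (frobenius_term f a k')"
    then have eq: "left_weight d k + CARD('p) * right_weight d k = left_weight d k' + CARD('p) * right_weight d k'"
      using degree_frobenius_term(1)[OF p a f(1,2)] by metis
    have "left_weight d k = left_weight d k'"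
      using arg_cong[OF eq, of "\<lambda>n. n mod CARD('p)"] I(2) k by simp
    moreover from this have "right_weight d k = right_weight d k'" using eq by simp
    ultimately show "k = k'" using weights_inj f(3) by blast
  qed
qed (rule degree_frobenius_term(2)[OF p a f(1,2)])

lemma degree_frobenius_poly_le:
  fixes f :: "'p::prime_card mod_ring poly"
  assumes p: "2 < CARD('p)" and a: "a \<noteq> 0" and f: "degree f = d" "f \<noteq> 0"
    and I: "finite I" "\<And>k. k \<in> I \<Longrightarrow> left_weight d k \<le> A" "\<And>k. k \<in> I \<Longrightarrow> right_weight d k \<le> B"
  shows "2 * degree (frobenius_poly f a I v) \<le> A + CARD('p) * B"
proof -
  have "degree (frobenius_poly f a I v) \<le> (A + CARD('p) * B) div 2"
    unfolding frobenius_poly_def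
  proof (rule degree_sum_le[OF I(1)])
    fix k assume k: "k \<in> I"
    have "2 * degree (frobenius_term f a k) \<le> A + CARD('p) * B"
      unfolding degree_frobenius_term(1)[OF p a f] using I(2,3)[OF k] by (intro add_mono mult_le_mono2)
    then show "degree (smult (v k) (frobenius_term f a k)) \<le> (A + CARD('p) * B) div 2"
      using degree_smult_le[of "v k" "frobenius_term f a k"] by simp
  qed
  then show ?thesis by simp
qed

lemma diagonal_deriv_diff: "diagonal_deriv f I (\<lambda>k. v k - w k) j = diagonal_deriv f I v j - diagonal_deriv f I w j"
  by (simp add: diagonal_deriv_def smult_diff_left sum_subtractf)

section \<open>Square-root cancellation in character sums\<close>

definition char_sum :: "'p::prime_card mod_ring set \<Rightarrow> int" where
  "char_sum Z = (\<Sum>u\<in>UNIV. qchar (\<Prod>z\<in>Z. u - z))"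

text \<open>
  A point \<open>u\<close> with \<open>\<chi> (f u) = s\<close> counts twice, a root of \<open>f\<close> once, and together these counts are \<open>p + s * char_sum Z\<close>. On the other
  hand \<open>m\<close> times the count is at most \<open>2 * degree \<Phi> \<le> (p - 1) + p (m + 2 g - 1)\<close>. Both signs \<open>s\<close> are needed; they
  share the same coefficients \<open>v\<close>.
\<close>

theorem char_sum_odd_bound:
  fixes Z :: "'p::prime_card mod_ring set"
  assumes p: "2 < CARD('p)" and Z: "card Z = 2 * g + 1" and g: "0 < g"
    and m: "0 < m" "m\<^sup>2 + m < CARD('p)"
  shows "int m * \<bar>char_sum Z\<bar> \<le> 2 * int g * int CARD('p) - 1"
proof -
  let ?p = "CARD('p)" and ?q = "CARD('p) div 2" and ?B = "m + 2 * g - 1"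
  have pq: "?p = 2 * ?q + 1" using odd_prime_card[OF p] by presburger
  have "card Z \<le> card (UNIV :: 'p mod_ring set)" by (rule card_mono) auto
  then have gq: "g \<le> ?q" using Z pq by simp
  define f where "f = (\<Prod>z\<in>Z. [:- z, 1:])"
  have polyf: "poly f u = (\<Prod>z\<in>Z. u - z)" for u by (simp add: f_def poly_prod)
  have polyf0: "poly f u = 0 \<longleftrightarrow> u \<in> Z" for u by (simp add: polyf)
  have degf: "degree f = 2 * g + 1" unfolding f_def by (subst degree_prod_eq_sum_degree) (auto simp: Z)
  have "lead_coeff f = 1" unfolding f_def by (simp add: lead_coeff_prod)
  then have lcf: "coeff f (2 * g + 1) = 1" using degf by simp
  then have f0: "f \<noteq> 0" by auto
  define e where "e = 2 * g - 1"
  have e: "e + 2 = 2 * g + 1" "odd e" "e - 1 = 2 * g - 2" using g by (auto simp: e_def)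
  let ?I = "unknowns ?q g m"
  have wI: "left_weight (2 * g + 1) k \<le> 2 * ?q" "right_weight (2 * g + 1) k \<le> ?B" if "k \<in> ?I" for k
    using unknowns_weights[OF that gq m(1)] by auto
  have less: "card (conditions ?q g m) < card ?I"
    using g gq m pq by (intro card_conditions_less_card_unknowns) auto
  let ?L = "\<lambda>v c. coeff (diagonal_deriv f ?I v (fst c)) (snd c)"
  have linear: "?L (\<lambda>k. v k - w k) c = ?L v c - ?L w c" for v w c by (simp add: diagonal_deriv_diff)
  obtain v where v: "\<exists>k\<in>?I. v k \<noteq> 0" and cond: "\<And>c. c \<in> conditions ?q g m \<Longrightarrow> ?L v c = 0"
    by (rule homogeneous_system_nontrivial[of _ _ ?L, OF finite_unknowns finite_conditions less linear]) blast
  \<comment> \<open>The solution of the linear system vanishes to order \<open>m\<close> on the diagonal.\<close>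
  have diag0: "diagonal_deriv f ?I v j = 0" if "j < m" for j
  proof (rule diagonal_deriv_eq_0[where f = f and e = e and A = "2 * ?q" and B = ?B and m = m])
    fix j c assume "j < m" "2 * c + of_bool (odd j) * (e + 2) \<le> 2 * ?q + ?B + j * (e - 1)"
    then have "(j, c) \<in> conditions ?q g m" unfolding conditions_def e by simp
    then show "coeff (diagonal_deriv f ?I v j) c = 0" using cond by fastforce
  qed (use p degf lcf e that pq wI finite_unknowns in \<open>auto simp del: left_weight.simps right_weight.simps\<close>)
  have mp: "m \<le> ?p" using m by simp
  have bound: "int m * (s * char_sum Z) \<le> 2 * int g * int ?p - 1" if s: "s = 1 \<or> s = -1" for s :: int
  proof -
    define a where "a = (of_int s :: 'p mod_ring)"
    have a: "a * a = 1" "a \<noteq> 0" using s by (auto simp: a_def)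
    define \<Phi> where "\<Phi> = frobenius_poly f a ?I v"
    define Good where "Good = {u. qchar (poly f u) = s}"
    have \<Phi>0: "\<Phi> \<noteq> 0"
      unfolding \<Phi>_def
    proof (rule frobenius_poly_neq_0[OF p a(2) degf f0 _ finite_unknowns _ v])
      fix k assume "k \<in> ?I"
      then show "left_weight (2 * g + 1) k < ?p" using wI(1) pq by (metis Suc_eq_plus1 less_Suc_eq_le)
    qed simp
    have ordGood: "m \<le> order u \<Phi>" if u: "u \<in> Good" for u
    proof -
      have "poly f u \<noteq> 0" using u s by (auto simp: Good_def)
      moreover have "poly f u ^ ?q = a" using u of_int_qchar[OF p, of "poly f u"] by (simp add: Good_def a_def)
      ultimately show ?thesis
        using poly_curve_deriv_iter_frobenius_poly[OF p a(1)] diag0 mp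
        by (intro order_ge_if_curve_derivs_vanish[OF \<Phi>0]) (auto simp: \<Phi>_def)
    qed
    have ordZ: "m \<le> 2 * order z \<Phi>" if z: "z \<in> Z" for z
    proof (rule order_ge_if_curve_derivs_vanish_root[OF p \<Phi>0])
      show "f = [:- z, 1:] * (\<Prod>z\<in>Z - {z}. [:- z, 1:])"
        unfolding f_def using z by (intro prod.remove) auto
      show "poly (\<Prod>z\<in>Z - {z}. [:- z, 1:]) z \<noteq> 0" by (auto simp: poly_prod)
      have "poly f z = 0" using z by (auto simp: polyf)
      then show "poly (curve_deriv_iter f False j \<Phi>) z = 0" if "j < m" "even j" for j
        using poly_curve_deriv_iter_frobenius_poly[OF p a(1)] diag0 that by (auto simp: \<Phi>_def)
    qed (rule mp)
    have disj: "Good \<inter> Z = {}" using s by (auto simp: Good_def polyf0[THEN iffD2])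
    have "2 * m * card Good + m * card Z = (\<Sum>u\<in>Good. 2 * m) + (\<Sum>u\<in>Z. m)" by simp
    also have "\<dots> \<le> (\<Sum>u\<in>Good. 2 * order u \<Phi>) + (\<Sum>u\<in>Z. 2 * order u \<Phi>)"
      using ordGood ordZ by (intro add_mono sum_mono) auto
    also have "\<dots> = 2 * (\<Sum>u\<in>Good \<union> Z. order u \<Phi>)"
      using disj by (subst sum.union_disjoint) (auto simp: sum_distrib_left)
    also have "(\<Sum>u\<in>Good \<union> Z. order u \<Phi>) \<le> (\<Sum>u\<in>UNIV. order u \<Phi>)" by (rule sum_mono2) auto
    also have "(\<Sum>u\<in>UNIV. order u \<Phi>) = (\<Sum>u | poly \<Phi> u = 0. order u \<Phi>)"
      by (rule sum.mono_neutral_right) (auto simp: order_0I)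
    also have "\<dots> \<le> degree \<Phi>" by (rule sum_order_le_degree[OF \<Phi>0])
    also have "2 * degree \<Phi> \<le> 2 * ?q + ?p * ?B"
      unfolding \<Phi>_def by (rule degree_frobenius_poly_le[OF p a(2) degf f0 finite_unknowns wI])
    finally have nat: "2 * m * card Good + m * card Z \<le> 2 * ?q + ?p * ?B" by simp
    \<comment> \<open>Pointwise, \<open>s \<chi>\<close> is twice the indicator of \<open>\<chi> = s\<close> plus that of \<open>\<chi> = 0\<close>, minus one.\<close>
    have "s * char_sum Z = (\<Sum>u\<in>UNIV. 2 * of_bool (u \<in> Good) + of_bool (u \<in> Z) - 1)"
      unfolding char_sum_def sum_distrib_left
    proof (rule sum.cong)
      fix u :: "'p mod_ring"
      have "(\<Prod>z\<in>Z. u - z) = poly f u" by (simp only: polyf)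
      then show "s * qchar (\<Prod>z\<in>Z. u - z) = 2 * of_bool (u \<in> Good) + of_bool (u \<in> Z) - 1"
        using qchar_cases[of "poly f u"] s by (cases "u \<in> Z") (auto simp: Good_def polyf0 polyf0[THEN iffD2])
    qed simp
    also have "\<dots> = 2 * int (card Good) + int (card Z) - int ?p"
      by (simp add: sum_subtractf sum.distrib sum_distrib_left[symmetric])
    finally have W: "s * char_sum Z = \<dots>" .
    have "int (2 * m * card Good + m * card Z) \<le> int (2 * ?q + ?p * ?B)" using nat by (simp only: of_nat_le_iff)
    moreover have "int ?B = int m + 2 * int g - 1" using m(1) by simp
    moreover have "int (2 * ?q) = int ?p - 1" using pq by simp
    ultimately have "int m * (2 * int (card Good) + int (card Z)) \<le> int ?p - 1 + int ?p * (int m + 2 * int g - 1)"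
      by (simp only: of_nat_add of_nat_mult of_nat_numeral) (simp add: algebra_simps)
    then show ?thesis unfolding W by (simp add: algebra_simps)
  qed
  show ?thesis using bound[of 1] bound[of "-1"] by (cases "char_sum Z \<ge> 0") auto
qed

lemma char_sum_singleton:
  fixes Z :: "'p::prime_card mod_ring set"
  assumes p: "2 < CARD('p)" and "card Z = 1"
  shows "char_sum Z = 0"
proof -
  obtain z where "Z = {z}" using assms(2) card_1_singletonE by blast
  then have "char_sum Z = (\<Sum>u\<in>UNIV. qchar (u - z))" by (simp add: char_sum_def)
  also have "\<dots> = (\<Sum>u\<in>(UNIV :: 'p mod_ring set). qchar u)"
    by (rule sum.reindex_bij_witness[of _ "\<lambda>u. u + z" "\<lambda>u. u - z"]) auto
  finally show ?thesis using sum_qchar_eq_0[OF p] by simp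
qed

lemma abs_qchar_le_1: "\<bar>qchar x\<bar> \<le> 1"
  using qchar_cases[of x] by auto

text \<open>
  The substitution \<open>u = z0 + 1 / v\<close> moves the root \<open>z0\<close> to infinity. The power of \<open>v\<close> that clears denominators has the even
  exponent \<open>card Z\<close>, so the character does not see it. The \<open>1\<close> accounts for \<open>v = 0\<close>.
\<close>

lemma char_sum_even_reduction:
  fixes Z :: "'p::prime_card mod_ring set"
  assumes p: "2 < CARD('p)" and Z: "card Z = 2 * n + 2"
  obtains Z' :: "'p mod_ring set" where "card Z' = 2 * n + 1" and "\<bar>char_sum Z\<bar> \<le> \<bar>char_sum Z'\<bar> + 1"
proof -
  obtain z0 where z0: "z0 \<in> Z" using Z by fastforce
  define Z1 where "Z1 = Z - {z0}"
  define Z' where "Z' = (\<lambda>z. inverse (z - z0)) ` Z1"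
  define c where "c = (\<Prod>z\<in>Z1. - (z - z0))"
  have cZ1: "card Z1 = 2 * n + 1" using Z z0 by (simp add: Z1_def)
  have inj: "inj_on (\<lambda>z. inverse (z - z0)) Z1" by (rule inj_onI) simp
  have P: "qchar (\<Prod>z\<in>Z. (z0 + inverse v) - z) = qchar c * qchar (\<Prod>z\<in>Z'. v - z)" if v: "v \<noteq> 0" for v
  proof -
    have "(\<Prod>z\<in>Z. (z0 + inverse v) - z) = inverse v * (\<Prod>z\<in>Z1. (z0 + inverse v) - z)"
      using z0 by (simp add: Z1_def prod.remove)
    also have "(\<Prod>z\<in>Z1. (z0 + inverse v) - z) = (\<Prod>z\<in>Z1. inverse v * (- (z - z0) * (v - inverse (z - z0))))"
    proof (rule prod.cong)
      fix z assume "z \<in> Z1"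
      then have w: "z - z0 \<noteq> 0" by (simp add: Z1_def)
      have "inverse v * (- w * (v - w')) = inverse v * (w * w') - w * (inverse v * v)" for w w'
        by (simp add: algebra_simps)
      also have "inverse v * ((z - z0) * inverse (z - z0)) - (z - z0) * (inverse v * v) = (z0 + inverse v) - z"
        unfolding right_inverse[OF w] left_inverse[OF v] by simp
      finally show "(z0 + inverse v) - z = inverse v * (- (z - z0) * (v - inverse (z - z0)))" ..
    qed simp
    also have "\<dots> = inverse v ^ (2 * n + 1) * (c * (\<Prod>z\<in>Z1. v - inverse (z - z0)))"
      unfolding prod.distrib c_def by (simp add: cZ1)
    also have "(\<Prod>z\<in>Z1. v - inverse (z - z0)) = (\<Prod>z\<in>Z'. v - z)"
      unfolding Z'_def by (subst prod.reindex[OF inj]) simp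
    also have "inverse v * (inverse v ^ (2 * n + 1) * (c * (\<Prod>z\<in>Z'. v - z)))
      = (inverse v ^ (n + 1))\<^sup>2 * (c * (\<Prod>z\<in>Z'. v - z))"
    proof -
      have "(n + 1) * 2 = Suc (2 * n + 1)" by simp
      then have "(inverse v ^ (n + 1))\<^sup>2 = inverse v * inverse v ^ (2 * n + 1)"
        by (metis power_Suc power_mult)
      then show ?thesis by (simp only: mult.assoc)
    qed
    finally show ?thesis
      using v by (simp add: qchar_mult[OF p] qchar_square[OF p])
  qed
  have "char_sum Z = (\<Sum>u\<in>UNIV - {z0}. qchar (\<Prod>z\<in>Z. u - z))"
    unfolding char_sum_def
  proof (rule sum.mono_neutral_right)
    have "(\<Prod>z\<in>Z. z0 - z) = 0" using z0 by auto
    then show "\<forall>u\<in>UNIV - (UNIV - {z0}). qchar (\<Prod>z\<in>Z. u - z) = 0" by simp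
  qed auto
  also have "\<dots> = (\<Sum>v\<in>UNIV - {0}. qchar (\<Prod>z\<in>Z. (z0 + inverse v) - z))"
    by (rule sum.reindex_bij_witness[of _ "\<lambda>v. z0 + inverse v" "\<lambda>u. inverse (u - z0)"]) auto
  also have "\<dots> = (\<Sum>v\<in>UNIV - {0}. qchar c * qchar (\<Prod>z\<in>Z'. v - z))"
    by (rule sum.cong) (use P in auto)
  also have "\<dots> = qchar c * (char_sum Z' - qchar (\<Prod>z\<in>Z'. 0 - z))"
    by (simp add: char_sum_def sum_distrib_left[symmetric] sum_diff1 del: diff_0)
  finally have "\<bar>char_sum Z\<bar> = \<bar>qchar c\<bar> * \<bar>char_sum Z' - qchar (\<Prod>z\<in>Z'. 0 - z)\<bar>"
    by (simp only: abs_mult)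
  also have "\<dots> \<le> 1 * \<bar>char_sum Z' - qchar (\<Prod>z\<in>Z'. 0 - z)\<bar>"
    using abs_qchar_le_1 by (intro mult_right_mono) auto
  also have "\<dots> \<le> \<bar>char_sum Z'\<bar> + 1"
  proof -
    have "\<bar>x - t\<bar> \<le> \<bar>x\<bar> + 1" if "\<bar>t\<bar> \<le> 1" for x t :: int
      using abs_triangle_ineq4[of x t] that by linarith
    then show ?thesis unfolding mult_1 using abs_qchar_le_1 by blast
  qed
  finally have "\<bar>char_sum Z\<bar> \<le> \<bar>char_sum Z'\<bar> + 1" .
  moreover have "card Z' = 2 * n + 1" unfolding Z'_def using card_image[OF inj] cZ1 by simp
  ultimately show thesis using that by blast
qed

section \<open>Explicit numerical bounds\<close>

text \<open>
  The largest \<open>m\<close> that \<open>char_sum_odd_bound\<close> admits; it differs from the square root of \<open>p\<close> by at most \<open>3 / 2\<close>.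
\<close>

lemma oblong_floor:
  assumes "2 < (p :: nat)"
  obtains m where "0 < m" "m\<^sup>2 + m < p" "p \<le> m\<^sup>2 + 3 * m + 2"
proof -
  define n where "n = (LEAST n. p \<le> n\<^sup>2 + n)"
  have "p \<le> p\<^sup>2 + p" by simp
  then have n: "p \<le> n\<^sup>2 + n" unfolding n_def by (rule LeastI)
  have less: "i\<^sup>2 + i < p" if "i < n" for i
    using not_less_Least[of i "\<lambda>n. p \<le> n\<^sup>2 + n"] that unfolding n_def by auto
  have "1 < n"
  proof (rule ccontr)
    assume "\<not> 1 < n"
    then have "n = 0 \<or> n = 1" by auto
    then show False using n assms by auto
  qed
  then obtain m where m: "n = Suc m" "0 < m" by (cases n) auto
  show thesis
    using that[of m] m n less[of m] by (simp add: power2_eq_square)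
qed

lemma sqrt_less_oblong:
  assumes "p \<le> m\<^sup>2 + 3 * m + 2"
  shows "sqrt (real p) < real m + 3 / 2"
proof -
  have "real p \<le> (real m)\<^sup>2 + 3 * real m + 2" using assms by (simp flip: of_nat_power of_nat_mult of_nat_add)
  also have "\<dots> < (real m + 3 / 2)\<^sup>2" by (simp add: power2_eq_square algebra_simps)
  finally show ?thesis by (simp add: real_less_lsqrt)
qed

lemma less_sqrt_oblong:
  assumes "m\<^sup>2 + m < p"
  shows "real m < sqrt (real p)"
proof (rule real_less_rsqrt)
  have "m\<^sup>2 < p" using assms by simp
  then show "(real m)\<^sup>2 < real p" by (simp flip: of_nat_power)
qed

text \<open>
  The bound \<open>(2 g r\<^sup>2 - 1) / m\<close> with \<open>m > r - 3 / 2\<close> exceeds \<open>2 g r\<close> by roughly \<open>3 g\<close>, which \<open>r / 2\<close> absorbs when \<open>r \<ge> 8 g\<close>.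
\<close>

lemma char_sum_odd_large:
  fixes Z :: "'p::prime_card mod_ring set"
  defines "r \<equiv> sqrt (real CARD('p))"
  assumes p: "2 < CARD('p)" and Z: "card Z = 2 * g + 1" and r: "8 * real g \<le> r"
  shows "real_of_int \<bar>char_sum Z\<bar> \<le> (2 * real g + 1 / 2) * r - 1 / 2"
proof (cases "g = 0")
  case True
  have "1 \<le> r" using p by (simp add: r_def)
  then show ?thesis using True char_sum_singleton[OF p, of Z] Z by simp
next
  case False
  then have g: "0 < g" by simp
  obtain m where m: "0 < m" "m\<^sup>2 + m < CARD('p)" "CARD('p) \<le> m\<^sup>2 + 3 * m + 2"
    using oblong_floor[OF p] .
  have mr: "real m < r" "r < real m + 3 / 2"
    unfolding r_def using less_sqrt_oblong[OF m(2)] sqrt_less_oblong[OF m(3)] by auto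
  have "8 * real g < real m + 3 / 2" using r mr by simp
  then have "real (8 * g) < real (m + 2)" by simp
  then have "8 * g < m + 2" by (simp only: of_nat_less_iff)
  \<comment> \<open>Integrality turns \<open>8 g < m + 3 / 2\<close> into \<open>8 g \<le> m + 1\<close>.\<close>
  then have mg: "6 * real g + 1 \<le> real m" using g by linarith
  have rr: "real CARD('p) = r * r" by (simp add: r_def)
  have "real_of_int (int m * \<bar>char_sum Z\<bar>) \<le> real_of_int (2 * int g * int CARD('p) - 1)"
    using char_sum_odd_bound[OF p Z g m(1,2)] by (simp only: of_int_le_iff)
  then have "real m * real_of_int \<bar>char_sum Z\<bar> \<le> 2 * real g * (r * r) - 1"
    by (simp flip: rr)
  also have "\<dots> \<le> real m * ((2 * real g + 1 / 2) * r - 1 / 2)"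
  proof -
    have "r * (2 * real g * r - real m * (2 * real g + 1 / 2)) \<le> r * (3 * real g - real m / 2)"
    proof (rule mult_left_mono)
      have "real g * r \<le> real g * (real m + 3 / 2)" using mr by (intro mult_left_mono) auto
      then show "2 * real g * r - real m * (2 * real g + 1 / 2) \<le> 3 * real g - real m / 2"
        by (simp add: algebra_simps)
    qed (use mr in simp)
    also have "\<dots> \<le> real m * (3 * real g - real m / 2)"
      using mr mg by (intro mult_right_mono_neg) auto
    also have "\<dots> \<le> real m * (- 1 / 2)"
      using mg by (intro mult_left_mono) auto
    finally show ?thesis by (simp add: algebra_simps)
  qed
  finally show ?thesis using m(1) by simp
qed

lemma char_sum_even_large:
  fixes Z :: "'p::prime_card mod_ring set"
  defines "r \<equiv> sqrt (real CARD('p))"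
  assumes p: "2 < CARD('p)" and Z: "card Z = 2 * g + 2" and r: "8 * real g \<le> r"
  shows "real_of_int \<bar>char_sum Z\<bar> \<le> (2 * real g + 1 / 2) * r + 1 / 2"
proof -
  obtain Z' :: "'p mod_ring set" where Z': "card Z' = 2 * g + 1" "\<bar>char_sum Z\<bar> \<le> \<bar>char_sum Z'\<bar> + 1"
    using char_sum_even_reduction[OF p Z] .
  then have "real_of_int \<bar>char_sum Z\<bar> \<le> real_of_int \<bar>char_sum Z'\<bar> + 1"
    by (metis of_int_1 of_int_add of_int_le_iff)
  then show ?thesis using char_sum_odd_large[OF p Z'(1)] r unfolding r_def by simp
qed

text \<open>
  For the elliptic case a weaker bound suffices, but it has to hold for all \<open>r > 4\<close>. In this range only \<open>p = 17\<close> and \<open>p = 19\<close> have \<open>m = 3\<close>; for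
  these primes the integrality of the character sum helps.
\<close>

lemma char_sum_card_3:
  fixes Z :: "'p::prime_card mod_ring set"
  defines "r \<equiv> sqrt (real CARD('p))"
  assumes p: "2 < CARD('p)" and Z: "card Z = 3" and r: "4 < r"
  shows "real_of_int \<bar>char_sum Z\<bar> \<le> 3 * r - 1"
proof -
  obtain m where m: "0 < m" "m\<^sup>2 + m < CARD('p)" "CARD('p) \<le> m\<^sup>2 + 3 * m + 2"
    using oblong_floor[OF p] .
  have mr: "real m < r" "r < real m + 3 / 2"
    unfolding r_def using less_sqrt_oblong[OF m(2)] sqrt_less_oblong[OF m(3)] by auto
  have rr: "real CARD('p) = r * r" by (simp add: r_def)
  have b: "int m * \<bar>char_sum Z\<bar> \<le> 2 * int CARD('p) - 1"
    using char_sum_odd_bound[of Z 1 m, OF p _ _ m(1,2)] Z by simp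
  show ?thesis
  proof (cases "4 \<le> m")
    case True
    have "real_of_int (int m * \<bar>char_sum Z\<bar>) \<le> real_of_int (2 * int CARD('p) - 1)"
      using b by (simp only: of_int_le_iff)
    then have "real m * real_of_int \<bar>char_sum Z\<bar> \<le> 2 * (r * r) - 1"
      by (simp flip: rr)
    also have "\<dots> \<le> real m * (3 * r - 1)"
    proof -
      have "r * (2 * r - 3 * real m) \<le> r * (3 - real m)"
        using mr by (intro mult_left_mono) auto
      also have "\<dots> \<le> real m * (3 - real m)"
        using mr True by (intro mult_right_mono_neg) auto
      also have "\<dots> \<le> real m * (- 1)"
        using True by (intro mult_left_mono) auto
      finally show ?thesis by (simp add: algebra_simps)
    qed
    finally show ?thesis using m(1) by simp
  next
    case False
    have "16 < CARD('p)"
    proof -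
      have "4 * 4 < r * r" using r by (intro mult_strict_mono) auto
      then show ?thesis using rr by simp
    qed
    have "\<not> m \<le> 2"
    proof
      assume "m \<le> 2"
      then have "m\<^sup>2 \<le> 2\<^sup>2" by (rule power_mono) simp
      then show False using m(3) \<open>m \<le> 2\<close> \<open>16 < CARD('p)\<close> by simp
    qed
    then have m3: "m = 3" using False by simp
    then have "CARD('p) \<le> 20" using m(3) by simp
    then have "CARD('p) = 17 \<or> CARD('p) = 19"
      using \<open>16 < CARD('p)\<close> odd_prime_card[OF p] by presburger
    then show ?thesis
    proof
      assume c: "CARD('p) = 17"
      have "\<bar>char_sum Z\<bar> \<le> 11" using b unfolding m3 c by simp
      then have "real_of_int \<bar>char_sum Z\<bar> \<le> 11" by linarith
      then show ?thesis using r by linarith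
    next
      assume c: "CARD('p) = 19"
      have "\<bar>char_sum Z\<bar> \<le> 12" using b unfolding m3 c by simp
      then have "real_of_int \<bar>char_sum Z\<bar> \<le> 12" by linarith
      moreover have "13 / 3 \<le> r" unfolding r_def c by (rule real_le_rsqrt) (simp add: power2_eq_square)
      ultimately show ?thesis by linarith
    qed
  qed
qed

lemma eight_times_le_odd_power: "1 \<le> g \<Longrightarrow> 8 * g \<le> 2 ^ (2 * g + 1)" for g :: nat
  by (induction g rule: nat_induct_at_least) auto

lemma eight_times_le_even_power: "2 \<le> g \<Longrightarrow> 8 * g \<le> 2 ^ (2 * g)" for g :: nat
  by (induction g rule: nat_induct_at_least) auto

section \<open>Character sums in a squared variable\<close>

definition square_char_sum :: "'p::prime_card mod_ring set \<Rightarrow> int" where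
  "square_char_sum S = (\<Sum>y\<in>UNIV. qchar (\<Prod>c\<in>S. y\<^sup>2 - c))"

text \<open>
  There are \<open>1 + \<chi> u\<close> square roots of \<open>u\<close>, and \<open>\<chi> u\<close> is absorbed into the product as the factor \<open>u - 0\<close>.
\<close>

lemma square_char_sum_eq:
  fixes S :: "'p::prime_card mod_ring set"
  assumes p: "2 < CARD('p)" and S: "0 \<notin> S"
  shows "square_char_sum S = char_sum S + char_sum (insert 0 S)"
proof -
  have "square_char_sum S = (\<Sum>u\<in>UNIV. (1 + qchar u) * qchar (\<Prod>c\<in>S. u - c))"
    unfolding square_char_sum_def by (rule sum_over_squares[OF p])
  also have "\<dots> = (\<Sum>u\<in>UNIV. qchar (\<Prod>c\<in>S. u - c) + qchar (\<Prod>c\<in>insert 0 S. u - c))"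
    using S by (intro sum.cong) (simp_all add: qchar_mult[OF p] distrib_right)
  finally show ?thesis by (simp add: sum.distrib char_sum_def)
qed

text \<open>
  Let \<open>s = card S\<close>. If \<open>s = 2 g + 1\<close>, both sums have genus \<open>g\<close>; if \<open>s = 2 g\<close>, the genera are \<open>g - 1\<close> and \<open>g\<close>. In both
  cases the two bounds add up to exactly \<open>(2 s - 1) r\<close> when \<open>s \<ge> 3\<close>, and \<open>2 ^ s < r\<close> guarantees \<open>8 g \<le> r\<close>. For \<open>s \<le> 2\<close>
  the genus is \<open>0\<close> except for the sum with three roots.
\<close>

lemma square_char_sum_bound:
  fixes S :: "'p::prime_card mod_ring set"
  defines "r \<equiv> sqrt (real CARD('p))"
  assumes p: "2 < CARD('p)" and S: "0 \<notin> S" "1 \<le> card S"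
    and r: "card S = 1 \<or> 2 ^ card S < r"
  shows "real_of_int \<bar>square_char_sum S\<bar> \<le> (2 * real (card S) - 1) * r"
proof -
  have c0: "card (insert 0 S) = card S + 1" using S(1) by simp
  have "real_of_int \<bar>square_char_sum S\<bar> \<le> real_of_int \<bar>char_sum S\<bar> + real_of_int \<bar>char_sum (insert 0 S)\<bar>"
    unfolding square_char_sum_eq[OF p S(1)] by simp
  also have "\<dots> \<le> (2 * real (card S) - 1) * r"
  proof -
    consider "card S = 1" | "card S = 2" | g where "1 \<le> g" "card S = 2 * g + 1" | g where "2 \<le> g" "card S = 2 * g"
    proof -
      have "\<exists>g. card S = 2 * g \<or> card S = 2 * g + 1" by presburger
      then obtain g where g: "card S = 2 * g \<or> card S = 2 * g + 1" by blast
      show thesis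
        using g S(2) that by (cases "g = 0"; cases "g = 1") auto
    qed
    then show ?thesis
    proof cases
      case 1
      have r1: "1 \<le> r" using p by (simp add: r_def)
      obtain Z' :: "'p mod_ring set" where "card Z' = 2 * 0 + 1" "\<bar>char_sum (insert 0 S)\<bar> \<le> \<bar>char_sum Z'\<bar> + 1"
        by (rule char_sum_even_reduction[OF p, of "insert 0 S" 0]) (use c0 1 in auto)
      then have "\<bar>char_sum (insert 0 S)\<bar> \<le> 1" using char_sum_singleton[OF p, of Z'] by simp
      then have "real_of_int \<bar>char_sum (insert 0 S)\<bar> \<le> 1" by linarith
      then show ?thesis using char_sum_singleton[OF p 1] r1 1 by simp
    next
      case 2
      then have "4 < r" using r by simp
      obtain Z' :: "'p mod_ring set" where "card Z' = 2 * 0 + 1" "\<bar>char_sum S\<bar> \<le> \<bar>char_sum Z'\<bar> + 1"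
        by (rule char_sum_even_reduction[OF p, of S 0]) (use 2 in auto)
      then have "\<bar>char_sum S\<bar> \<le> 1" using char_sum_singleton[OF p, of Z'] by simp
      then have "real_of_int \<bar>char_sum S\<bar> \<le> 1" by linarith
      then show ?thesis
        using char_sum_card_3[OF p, of "insert 0 S"] \<open>4 < r\<close> c0 2 unfolding r_def by simp
    next
      case (3 g)
      have "2 ^ (2 * g + 1) < r" using r 3 by simp
      moreover have "real (8 * g) \<le> real (2 ^ (2 * g + 1))"
        using eight_times_le_odd_power[OF 3(1)] by (simp only: of_nat_le_iff)
      ultimately have "8 * real g \<le> r" by simp
      then show ?thesis
        using char_sum_odd_large[OF p 3(2)] char_sum_even_large[OF p, of "insert 0 S" g] c0 3(2)
        unfolding r_def by (simp add: algebra_simps)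
    next
      case (4 g)
      have "2 ^ (2 * g) < r" using r 4 by simp
      moreover have "real (8 * g) \<le> real (2 ^ (2 * g))"
        using eight_times_le_even_power[OF 4(1)] by (simp only: of_nat_le_iff)
      ultimately have r8: "8 * real g \<le> r" by simp
      have g1: "real (g - 1) = real g - 1" using 4(1) by (simp add: of_nat_diff)
      have "real_of_int \<bar>char_sum S\<bar> \<le> (2 * real (g - 1) + 1 / 2) * r + 1 / 2"
        unfolding r_def by (rule char_sum_even_large[OF p]) (use r8 4 g1 in \<open>auto simp: r_def\<close>)
      moreover have "real_of_int \<bar>char_sum (insert 0 S)\<bar> \<le> (2 * real g + 1 / 2) * r - 1 / 2"
        unfolding r_def by (rule char_sum_odd_large[OF p]) (use r8 4 c0 in \<open>auto simp: r_def\<close>)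
      ultimately show ?thesis unfolding 4(2) g1 by (simp add: algebra_simps)
    qed
  qed
  finally show ?thesis .
qed

section \<open>Counting joint nonresidues\<close>

definition joint_nonresidues :: "'p::prime_card mod_ring set \<Rightarrow> 'p mod_ring set" where
  "joint_nonresidues C = {y. \<forall>c\<in>C. qchar (y\<^sup>2 - c) = -1}"

text \<open>
  The product is \<open>2 ^ card C\<close> at joint nonresidues. Elsewhere it is nonzero only if some factor is \<open>1\<close>, because
  \<open>y\<^sup>2\<close> lies in \<open>C\<close>, and then it is at most \<open>2 ^ (card C - 1)\<close>.
\<close>

lemma prod_one_minus_qchar_bounds:
  fixes C :: "'p::prime_card mod_ring set" and y :: "'p mod_ring"
  assumes C: "C \<noteq> {}"
  defines "P \<equiv> \<Prod>c\<in>C. 1 - qchar (y\<^sup>2 - c)"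
  shows "2 ^ card C * of_bool (y \<in> joint_nonresidues C) \<le> P"
    and "2 * P \<le> 2 * 2 ^ card C * of_bool (y \<in> joint_nonresidues C) + 2 ^ card C * of_bool (y\<^sup>2 \<in> C)"
proof -
  have range: "0 \<le> 1 - qchar x \<and> 1 - qchar x \<le> 2" for x :: "'p mod_ring"
    using qchar_cases[of x] by auto
  have nonneg: "0 \<le> P" unfolding P_def using range by (intro prod_nonneg) auto
  have "P = 2 ^ card C" if "y \<in> joint_nonresidues C"
    using that by (simp add: P_def joint_nonresidues_def)
  moreover have "2 * P \<le> 2 ^ card C * of_bool (y\<^sup>2 \<in> C)" if y: "y \<notin> joint_nonresidues C"
  proof (cases "\<exists>c\<in>C. qchar (y\<^sup>2 - c) = 1")
    case True
    then have "P = 0" by (auto simp: P_def)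
    then show ?thesis by simp
  next
    case False
    from y obtain c where c: "c \<in> C" "qchar (y\<^sup>2 - c) \<noteq> -1" by (auto simp: joint_nonresidues_def)
    then have q0: "qchar (y\<^sup>2 - c) = 0" using False qchar_cases[of "y\<^sup>2 - c"] by auto
    then have "y\<^sup>2 \<in> C" using c by simp
    have "P = (1 - qchar (y\<^sup>2 - c)) * (\<Prod>c\<in>C - {c}. 1 - qchar (y\<^sup>2 - c))"
      unfolding P_def using c by (intro prod.remove) auto
    also have "\<dots> = (\<Prod>c\<in>C - {c}. 1 - qchar (y\<^sup>2 - c))" using q0 by simp
    also have "\<dots> \<le> (\<Prod>c\<in>C - {c}. 2)" using range by (intro prod_mono) auto
    also have "\<dots> = 2 ^ (card C - 1)" using c by simp
    finally have "2 * P \<le> 2 ^ Suc (card C - 1)" by simp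
    moreover have "Suc (card C - 1) = card C" using C by (simp add: card_gt_0_iff)
    ultimately show ?thesis using \<open>y\<^sup>2 \<in> C\<close> by simp
  qed
  ultimately show "2 ^ card C * of_bool (y \<in> joint_nonresidues C) \<le> P"
    and "2 * P \<le> 2 * 2 ^ card C * of_bool (y \<in> joint_nonresidues C) + 2 ^ card C * of_bool (y\<^sup>2 \<in> C)"
    using nonneg by (cases "y \<in> joint_nonresidues C"; simp)+
qed

lemma sum_prod_one_minus_qchar:
  fixes C :: "'p::prime_card mod_ring set"
  assumes p: "2 < CARD('p)"
  shows "(\<Sum>y\<in>UNIV. \<Prod>c\<in>C. 1 - qchar (y\<^sup>2 - c)) = (\<Sum>S\<in>Pow C. (-1) ^ card S * square_char_sum S)"
proof -
  have "(\<Sum>y\<in>UNIV. \<Prod>c\<in>C. 1 - qchar (y\<^sup>2 - c))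
    = (\<Sum>y\<in>UNIV. \<Sum>S\<in>Pow C. (-1) ^ card S * qchar (\<Prod>c\<in>S. y\<^sup>2 - c))"
    by (subst prod_diff_conv_sum) (simp_all add: qchar_prod[OF p])
  also have "\<dots> = (\<Sum>S\<in>Pow C. \<Sum>y\<in>UNIV. (-1) ^ card S * qchar (\<Prod>c\<in>S. y\<^sup>2 - c))"
    by (rule sum.swap)
  finally show ?thesis by (simp add: square_char_sum_def sum_distrib_left)
qed

text \<open>
  Pair each subset with its complement.
\<close>

lemma sum_card_Pow:
  assumes "finite C"
  shows "2 * (\<Sum>S\<in>Pow C. card S) = card C * 2 ^ card C"
proof -
  have "(\<Sum>S\<in>Pow C. card S) = (\<Sum>S\<in>Pow C. card (C - S))"
    by (rule sum.reindex_bij_witness[of _ "\<lambda>S. C - S" "\<lambda>S. C - S"]) (auto simp: double_diff)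
  then have "2 * (\<Sum>S\<in>Pow C. card S) = (\<Sum>S\<in>Pow C. card S + card (C - S))"
    by (simp add: sum.distrib)
  also have "\<dots> = (\<Sum>S\<in>Pow C. card C)"
  proof (rule sum.cong)
    fix S assume "S \<in> Pow C"
    then have "S \<subseteq> C" "finite S" using assms finite_subset by auto
    then show "card S + card (C - S) = card C" using assms by (simp add: card_Diff_subset card_mono)
  qed simp
  finally show ?thesis using assms by (simp add: card_Pow)
qed

text \<open>
  Summing \<open>(2 s - 1) r\<close> over the nonempty subsets gives \<open>(k 2 ^ k - 2 ^ k + 1) r\<close>, and division by \<open>2 ^ k\<close> yields the
  coefficient \<open>k - 1 + 1 / 2 ^ k\<close> of \<open>r\<close>. The additional \<open>k\<close> comes from the at most \<open>2 k\<close> values \<open>y\<close> with \<open>y\<^sup>2\<close> in \<open>C\<close>, each of which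
  perturbs the count by at most \<open>1 / 2\<close>.
\<close>

lemma card_joint_nonresidues_large:
  fixes C :: "'p::prime_card mod_ring set"
  defines "r \<equiv> sqrt (real CARD('p))" and "k \<equiv> card C"
  assumes p: "2 < CARD('p)" and C: "0 \<notin> C" "1 \<le> k" and r: "k = 1 \<or> 2 ^ k < r"
  shows "\<bar>real (card (joint_nonresidues C)) - real CARD('p) / 2 ^ k\<bar> \<le> (real k - 1 + 1 / 2 ^ k) * r + real k"
proof -
  let ?M = "joint_nonresidues C"
  let ?\<Sigma> = "\<Sum>y\<in>UNIV. \<Prod>c\<in>C. 1 - qchar (y\<^sup>2 - c)"
  have fin: "finite C" by simp
  have Cne: "C \<noteq> {}" using C by (auto simp: k_def)
  define E where "E = (\<Sum>S\<in>Pow C - {{}}. (-1) ^ card S * square_char_sum S)"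
  have "?\<Sigma> = square_char_sum ({} :: 'p mod_ring set) + E"
    unfolding sum_prod_one_minus_qchar[OF p] E_def by (subst sum.remove[of _ "{}"]) auto
  then have \<Sigma>: "?\<Sigma> = int CARD('p) + E" by (simp add: square_char_sum_def)
  have "real_of_int \<bar>E\<bar> \<le> (\<Sum>S\<in>Pow C - {{}}. (2 * real (card S) - 1) * r)"
  proof -
    have "real_of_int \<bar>E\<bar> \<le> (\<Sum>S\<in>Pow C - {{}}. real_of_int \<bar>(-1) ^ card S * square_char_sum S\<bar>)"
      unfolding E_def of_int_sum[symmetric] of_int_le_iff by (rule sum_abs)
    also have "\<dots> \<le> (\<Sum>S\<in>Pow C - {{}}. (2 * real (card S) - 1) * r)"
    proof (rule sum_mono)
      fix S assume S: "S \<in> Pow C - {{}}"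
      have "card S \<le> k" unfolding k_def using S by (intro card_mono) auto
      moreover have "1 \<le> card S" using S by (simp add: card_gt_0_iff Suc_le_eq)
      moreover have "(2::real) ^ card S \<le> 2 ^ k" using \<open>card S \<le> k\<close> by (intro power_increasing) auto
      ultimately have b: "card S = 1 \<or> 2 ^ card S < r"
        using r by (metis le_antisym order_le_less_trans)
      have "0 \<notin> S" using S C(1) by auto
      then have "real_of_int \<bar>square_char_sum S\<bar> \<le> (2 * real (card S) - 1) * r"
        using square_char_sum_bound[OF p \<open>0 \<notin> S\<close> \<open>1 \<le> card S\<close>] b unfolding r_def by blast
      then show "real_of_int \<bar>(-1) ^ card S * square_char_sum S\<bar> \<le> (2 * real (card S) - 1) * r"
        by (simp add: abs_mult)
    qed
    finally show ?thesis .
  qed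
  also have "\<dots> = (real k * 2 ^ k - 2 ^ k + 1) * r"
  proof -
    have "(\<Sum>S\<in>Pow C. 2 * real (card S) - 1) = (\<Sum>S\<in>Pow C - {{}}. 2 * real (card S) - 1) - 1"
      by (subst sum.remove[of _ "{}"]) auto
    moreover have "(\<Sum>S\<in>Pow C. 2 * real (card S) - 1) = real k * 2 ^ k - 2 ^ k"
    proof -
      have "real (2 * (\<Sum>S\<in>Pow C. card S)) = real (card C * 2 ^ card C)"
        using sum_card_Pow[OF fin] by (simp only:)
      then show ?thesis by (simp add: sum_subtractf sum_distrib_left[symmetric] card_Pow k_def)
    qed
    ultimately show ?thesis by (simp add: sum_distrib_right[symmetric])
  qed
  finally have E: "real_of_int \<bar>E\<bar> \<le> (real k * 2 ^ k - 2 ^ k + 1) * r" .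
  have roots: "card {y. y\<^sup>2 \<in> C} \<le> 2 * k"
  proof -
    have "{y. y\<^sup>2 \<in> C} = (\<Union>c\<in>C. {y. y\<^sup>2 = c})" by auto
    then have "card {y. y\<^sup>2 \<in> C} \<le> (\<Sum>c\<in>C. card {y. y\<^sup>2 = c})" using card_UN_le[OF fin] by metis
    also have "\<dots> \<le> (\<Sum>c\<in>C. 2)" by (rule sum_mono) (rule card_square_roots_le)
    finally show ?thesis by (simp add: k_def)
  qed
  have count: "(\<Sum>y\<in>UNIV. n * of_bool (y \<in> A)) = n * int (card A)" for n and A :: "'p mod_ring set"
    by (simp add: sum_distrib_left[symmetric])
  have lower: "2 ^ k * int (card ?M) \<le> ?\<Sigma>"
  proof -
    have "2 ^ k * int (card ?M) = (\<Sum>y\<in>UNIV. 2 ^ k * of_bool (y \<in> ?M))"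
      by (rule count[symmetric])
    also have "\<dots> \<le> ?\<Sigma>"
      unfolding k_def by (rule sum_mono) (rule prod_one_minus_qchar_bounds[OF Cne])
    finally show ?thesis .
  qed
  have upper: "2 * ?\<Sigma> \<le> 2 * 2 ^ k * int (card ?M) + 2 ^ k * (2 * int k)"
  proof -
    have "2 * ?\<Sigma> \<le> (\<Sum>y\<in>UNIV. 2 * 2 ^ k * of_bool (y \<in> ?M) + 2 ^ k * of_bool (y\<^sup>2 \<in> C))"
      unfolding sum_distrib_left k_def by (rule sum_mono) (rule prod_one_minus_qchar_bounds[OF Cne])
    also have "\<dots> = 2 * 2 ^ k * int (card ?M) + 2 ^ k * int (card {y. y\<^sup>2 \<in> C})"
      using count[of "2 ^ k" "{y. y\<^sup>2 \<in> C}"] by (simp only: sum.distrib count mem_Collect_eq)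
    also have "\<dots> \<le> 2 * 2 ^ k * int (card ?M) + 2 ^ k * (2 * int k)"
      using roots by (intro add_left_mono mult_left_mono) auto
    finally show ?thesis .
  qed
  define M where "M = real (card ?M)"
  have K: "(0::real) < 2 ^ k" by simp
  have "real_of_int (2 ^ k * int (card ?M)) \<le> real_of_int (int CARD('p) + E)"
    using lower unfolding \<Sigma> of_int_le_iff .
  then have lo: "2 ^ k * M \<le> real CARD('p) + real_of_int E" by (simp add: M_def)
  have "real_of_int (int CARD('p) + E) \<le> real_of_int (2 ^ k * int (card ?M) + 2 ^ k * int k)"
    using upper unfolding \<Sigma> of_int_le_iff by simp
  then have up: "real CARD('p) + real_of_int E \<le> 2 ^ k * M + 2 ^ k * real k" by (simp add: M_def)
  have "2 ^ k * \<bar>M - real CARD('p) / 2 ^ k\<bar> = \<bar>2 ^ k * (M - real CARD('p) / 2 ^ k)\<bar>"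
    by (simp add: abs_mult)
  also have "2 ^ k * (M - real CARD('p) / 2 ^ k) = 2 ^ k * M - real CARD('p)"
    by (simp add: right_diff_distrib)
  also have "\<bar>2 ^ k * M - real CARD('p)\<bar> \<le> (real k * 2 ^ k - 2 ^ k + 1) * r + 2 ^ k * real k"
  proof -
    have "0 \<le> 2 ^ k * real k" by simp
    then show ?thesis using lo up E unfolding of_int_abs by linarith
  qed
  also have "\<dots> = 2 ^ k * ((real k - 1 + 1 / 2 ^ k) * r + real k)"
    using K by (simp add: field_simps)
  finally show ?thesis using K unfolding M_def by simp
qed

text \<open>
  If \<open>r \<le> 2 ^ k\<close>, the right-hand side for \<open>k\<close> is at least that for \<open>k - 1\<close>, since the difference is
  \<open>(r + 1) (2 ^ k - r) / 2 ^ k\<close>; and dropping an element of \<open>C\<close> only enlarges the set.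
\<close>

lemma card_joint_nonresidues_upper:
  fixes C :: "'p::prime_card mod_ring set"
  defines "r \<equiv> sqrt (real CARD('p))"
  assumes p: "2 < CARD('p)" and C: "0 \<notin> C" "1 \<le> card C"
  shows "real (card (joint_nonresidues C))
    \<le> real CARD('p) / 2 ^ card C + (real (card C) - 1 + 1 / 2 ^ card C) * r + real (card C)"
  using C
proof (induction "card C" arbitrary: C rule: less_induct)
  case less
  let ?k = "card C"
  show ?case
  proof (cases "?k = 1 \<or> 2 ^ ?k < r")
    case True
    then show ?thesis
      using card_joint_nonresidues_large[OF p less.prems] unfolding r_def abs_le_iff by linarith
  next
    case False
    then have k: "2 \<le> ?k" and r: "r \<le> 2 ^ ?k" using less.prems by auto
    have r0: "0 \<le> r" and rr: "real CARD('p) = r * r" by (simp_all add: r_def)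
    obtain c where c: "c \<in> C" using less.prems by fastforce
    let ?C = "C - {c}"
    have card: "?k = Suc (card ?C)" using c k by simp
    have "card (joint_nonresidues C) \<le> card (joint_nonresidues ?C)"
      by (rule card_mono) (auto simp: joint_nonresidues_def)
    then have "real (card (joint_nonresidues C)) \<le> real (card (joint_nonresidues ?C))" by simp
    also have "\<dots> \<le> real CARD('p) / 2 ^ card ?C + (real (card ?C) - 1 + 1 / 2 ^ card ?C) * r + real (card ?C)"
      using less.prems k card by (intro less.hyps) auto
    also have "\<dots> \<le> real CARD('p) / 2 ^ ?k + (real ?k - 1 + 1 / 2 ^ ?k) * r + real ?k"
    proof -
      define K where "K = (2::real) ^ ?k"
      have K: "0 < K" "2 ^ card ?C = K / 2" by (simp_all add: K_def card)
      \<comment> \<open>This is \<open>(r + 1) (K - r) \<ge> 0\<close>.\<close>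
      have "r * r + r \<le> K * r + K"
        using mult_right_mono[OF r r0] r by (simp add: K_def)
      then have "(r * r + r) / K \<le> r + 1" using K by (simp add: field_simps)
      moreover have k1: "real (card ?C) = real ?k - 1" by (simp add: card)
      moreover have "r * r / (K / 2) = 2 * (r * r / K)" by simp
      moreover have "(real ?k - 1 - 1 + 1 / (K / 2)) * r = (real ?k - 1) * r - r + 2 * (r / K)"
        by (simp add: algebra_simps)
      moreover have "(real ?k - 1 + 1 / K) * r = (real ?k - 1) * r + r / K"
        by (simp add: algebra_simps)
      ultimately show ?thesis
        unfolding rr K(2) k1 K_def[symmetric] by (simp only: add_divide_distrib)
    qed
    finally show ?thesis .
  qed
qed

text \<open>
  In the remaining range \<open>r \<le> 2 ^ k\<close> the main term \<open>p / 2 ^ k\<close> is at most \<open>r\<close>, so the lower bound says nothing more than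
  that a cardinality is nonnegative.
\<close>

lemma card_joint_nonresidues:
  fixes C :: "'p::prime_card mod_ring set"
  defines "r \<equiv> sqrt (real CARD('p))" and "k \<equiv> card C"
  assumes p: "2 < CARD('p)" and C: "0 \<notin> C" "1 \<le> k"
  shows "\<bar>real (card (joint_nonresidues C)) - real CARD('p) / 2 ^ k\<bar> \<le> (real k - 1 + 1 / 2 ^ k) * r + real k"
proof (cases "k = 1 \<or> 2 ^ k < r")
  case True
  then show ?thesis using card_joint_nonresidues_large[OF p] C unfolding r_def k_def by blast
next
  case False
  then have k: "2 \<le> k" and r: "r \<le> 2 ^ k" using C by auto
  have r0: "0 \<le> r" and rr: "real CARD('p) = r * r" by (simp_all add: r_def)
  have "real CARD('p) / 2 ^ k \<le> r"
    unfolding rr using mult_right_mono[OF r r0] by (simp add: divide_le_eq mult.commute)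
  also have "r = 1 * r" by simp
  also have "\<dots> \<le> (real k - 1 + 1 / 2 ^ k) * r"
    using k r0 by (intro mult_right_mono) (auto intro: add_increasing2)
  finally have "real CARD('p) / 2 ^ k \<le> (real k - 1 + 1 / 2 ^ k) * r" .
  moreover have "real (card (joint_nonresidues C))
    \<le> real CARD('p) / 2 ^ k + (real k - 1 + 1 / 2 ^ k) * r + real k"
    using card_joint_nonresidues_upper[OF p C[unfolded k_def]] unfolding r_def k_def .
  moreover have "0 \<le> real (card (joint_nonresidues C))" "0 \<le> real k" by simp_all
  ultimately show ?thesis unfolding abs_le_iff by linarith
qed

section \<open>The union of the value sets\<close>

text \<open>
  The discriminant of \<open>a x\<^sup>2 - y x + N\<close> is \<open>y\<^sup>2 - 4 a N\<close>. In one direction it is the square of \<open>a x - N / x\<close>; in the other,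
  \<open>x = (y + t) / (2 a)\<close> for a square root \<open>t\<close> of it.
\<close>

lemma mem_H_iff:
  fixes a N :: "'p::prime_card mod_ring"
  assumes p: "2 < CARD('p)" and a: "a \<noteq> 0" and N: "N \<noteq> 0"
  shows "y \<in> H a N \<longleftrightarrow> qchar (y\<^sup>2 - 4 * a * N) \<noteq> -1"
proof
  assume "y \<in> H a N"
  then obtain x where x: "x \<noteq> 0" "y = a * x + N * inverse x" by (auto simp: H_def)
  have "(a * x + b)\<^sup>2 - 4 * (a * x * b) = (a * x - b)\<^sup>2" for b
    by (simp add: power2_eq_square algebra_simps)
  from this[of "N * inverse x"] have "y\<^sup>2 - 4 * a * N = (a * x - N * inverse x)\<^sup>2"
    using x by (simp add: mult_ac)
  then show "qchar (y\<^sup>2 - 4 * a * N) \<noteq> -1"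
    using qchar_square[OF p, of "a * x - N * inverse x"] by (cases "a * x - N * inverse x = 0") auto
next
  have two: "(2 :: 'p mod_ring) \<noteq> 0" by (rule mod_ring_two_neq_0[OF p])
  have "(4 :: 'p mod_ring) = 2 * 2" by simp
  then have four: "(4 :: 'p mod_ring) \<noteq> 0" using two by (metis mult_eq_0_iff)
  assume "qchar (y\<^sup>2 - 4 * a * N) \<noteq> -1"
  then have "\<exists>t. t\<^sup>2 = y\<^sup>2 - 4 * a * N"
    using qchar_cases[of "y\<^sup>2 - 4 * a * N"] qchar_eq_1_imp_square[OF p] by (metis power_zero_numeral)
  then obtain t where t: "t\<^sup>2 = y\<^sup>2 - 4 * a * N" by blast
  define s where "s = y + t"
  have "s \<noteq> 0"
  proof
    assume "s = 0"
    then have "t = - y" by (simp add: s_def eq_neg_iff_add_eq_0 add.commute)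
    then have "4 * a * N = 0" using t by simp
    then show False using a N four by simp
  qed
  have sq: "s\<^sup>2 + 4 * a * N = 2 * y * s"
    using t by (simp add: s_def power2_eq_square algebra_simps)
  define x where "x = s / (2 * a)"
  have ax: "2 * a * x = s" using a two by (simp add: x_def)
  then have x0: "x \<noteq> 0" using \<open>s \<noteq> 0\<close> by auto
  have "2 * s * (a * x + N * i) = s * (2 * a * x) + 2 * N * i * s" for i
    by (simp add: algebra_simps)
  also have "s * (2 * a * x) + 2 * N * inverse x * s = s * s + 2 * N * inverse x * (2 * a * x)"
    unfolding ax ..
  also have "\<dots> = s\<^sup>2 + 4 * a * N * (x * inverse x)"
    by (simp add: power2_eq_square mult_ac)
  also have "\<dots> = 2 * s * y"
    using sq x0 by (simp add: mult_ac)
  finally have "2 * s * (a * x + N * inverse x) = 2 * s * y" .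
  then have "a * x + N * inverse x = y" using \<open>s \<noteq> 0\<close> two by (simp only: mult_cancel_left) simp
  then show "y \<in> H a N" using x0 by (auto simp: H_def)
qed

theorem theorem8p1:
  fixes k l :: nat
    and N :: "'p::prime_card mod_ring"
    and a :: "nat \<Rightarrow> 'p mod_ring"
  assumes "k \<ge> 1"
    and "l = CARD('p)"
    and "l > 2"
    and "N \<noteq> 0"
    and "\<And>j. j \<in> {1..k} \<Longrightarrow> a j \<noteq> 0"
    and "inj_on a {1..k}"
  shows "\<bar>real (card (\<Union>j\<in>{1..k}. H (a j) N)) - real l * (1 - 1 / 2 ^ k)\<bar>
           \<le> (real k - 1 + 1 / 2 ^ k) * sqrt (real l) + real k"
proof -
  have p: "2 < CARD('p)" using assms(2,3) by simp
  have "(4 :: 'p mod_ring) = 2 * 2" by simp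
  then have four: "(4 :: 'p mod_ring) \<noteq> 0" using mod_ring_two_neq_0[OF p] by (metis mult_eq_0_iff)
  define C where "C = (\<lambda>j. 4 * a j * N) ` {1..k}"
  have "inj_on (\<lambda>j. 4 * a j * N) {1..k}"
  proof (rule inj_onI)
    fix i j assume ij: "i \<in> {1..k}" "j \<in> {1..k}" "4 * a i * N = 4 * a j * N"
    then have "a i = a j" using four assms(4) by (metis mult_left_cancel mult_right_cancel)
    then show "i = j" using inj_onD[OF assms(6) _ ij(1,2)] by blast
  qed
  then have card_C: "card C = k" unfolding C_def by (simp add: card_image)
  have C0: "0 \<notin> C"
  proof
    assume "0 \<in> C"
    then obtain j where j: "0 = 4 * a j * N" "j \<in> {1..k}" unfolding C_def by (rule imageE)
    from four assms(5)[OF j(2)] assms(4) have "4 * a j * N \<noteq> 0"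
      by (simp only: mult_eq_0_iff not_False_eq_True simp_thms)
    then show False using j(1) by (rule notE[OF _ sym])
  qed
  have H_iff: "y \<in> H (a j) N \<longleftrightarrow> qchar (y\<^sup>2 - 4 * a j * N) \<noteq> -1" if "j \<in> {1..k}" for y j
    by (rule mem_H_iff[OF p assms(5)[OF that] assms(4)])
  have "(\<Union>j\<in>{1..k}. H (a j) N) = UNIV - joint_nonresidues C"
    unfolding C_def joint_nonresidues_def using H_iff by blast
  then have "card (\<Union>j\<in>{1..k}. H (a j) N) = CARD('p) - card (joint_nonresidues C)"
    by (simp add: card_Diff_subset)
  moreover have "card (joint_nonresidues C) \<le> CARD('p)"
    using card_mono[of "UNIV :: 'p mod_ring set" "joint_nonresidues C"] by simp
  ultimately have "real (card (\<Union>j\<in>{1..k}. H (a j) N)) = real l - real (card (joint_nonresidues C))"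
    using assms(2) by (simp add: of_nat_diff)
  then have "\<bar>real (card (\<Union>j\<in>{1..k}. H (a j) N)) - real l * (1 - 1 / 2 ^ k)\<bar>
    = \<bar>real (card (joint_nonresidues C)) - real CARD('p) / 2 ^ card C\<bar>"
    unfolding card_C assms(2)[symmetric] by (subst abs_minus_commute) (simp add: algebra_simps)
  also have "\<dots> \<le> (real (card C) - 1 + 1 / 2 ^ card C) * sqrt (real CARD('p)) + real (card C)"
    using assms(1) card_C by (intro card_joint_nonresidues[OF p C0]) simp
  finally show ?thesis unfolding card_C assms(2)[symmetric] .
qed

end
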